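(* Let $\overline{x}=(\overline{c}^i,\overline{c}^j,\overline{k})$ be a stationary equilibrium of the dynamical system $x_{t+1}=\Phi(x_t)$ associated with the precommitment game $\mathcal{P}$, and assume that, with all quantities evaluated at $\overline{x}$, (P1) $\eta_i<0$ and $\eta_j<0$; (P2) $\delta_i\le\delta_j$; (P3) $f'(\overline{k})-\big(2\omega_i\omega_j+(\delta_i-\omega_i)\eta_j+\eta_i(\delta_j-\omega_j)\big)\ge0$. Then there exist a neighborhood $\mathcal{N}$ of $\overline{x}$ and a continuously differentiable function $\phi=(\phi^i,\phi^j):\mathcal{N}\to\mathbb{R}^2$, for which the Jacobian matrix $D\phi(\overline{x})$ has full rank (rank $2$), such that if $\{x_t\}_{t=0}^\infty$ is an equilibrium path for $\mathcal{P}$ with $x_0\in\mathcal{N}$ and $\phi(x_0)=0$, then $\lim_{t\to\infty}x_t=\overline{x}$.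
   Context: There are two agents $i$ and $j$, $j\ne i$. For each agent $l\in\{i,j\}$: the discount factor $\alpha_l:\mathbb{R}_+\to(0,\infty)$ is continuous, strictly increasing and strictly concave on $\mathbb{R}_+$, $C^2$ on $(0,\infty)$ with $\alpha_l''(c)<0<\alpha_l'(c)$ for all $c>0$, $\alpha_l(0)>0$, and $\sup_{c>0}\alpha_l(c)=\overline{\alpha}_l$ with $0<\overline{\alpha}_l<1$; the instantaneous utility $u_l:\mathbb{R}_+\to\mathbb{R}_+$ is continuous, strictly increasing and strictly concave on $\mathbb{R}_+$, $C^2$ on $(0,\infty)$ with $u_l''(c)<0<u_l'(c)$ for all $c>0$, $u_l(0)=0$, $\lim_{c\to0^+}u_l'(c)=+\infty$, $\lim_{c\to+\infty}u_l'(c)=0$. The production function $f:\mathbb{R}_+\to\mathbb{R}_+$ is continuous, strictly increasing and strictly concave on $\mathbb{R}_+$, $C^2$ on $(0,\infty)$ with $f''(k)<0<f'(k)$ for all $k>0$, $f(0)=0$, $\lim_{k\to0^+}f'(k)>\max\{\alpha_i(0)^{-1},\alpha_j(0)^{-1}\}$, and $\lim_{k\to+\infty}f'(k)<1$. The maximum sustainable capital $k_m>0$ is defined by $f(k_m)=k_m$, and $K=[0,k_m]$. The strategy spaces are compact intervals $S^l=[0,d_l(k_m)]\subset\mathbb{R}_+$, where $d_l(k)$ denotes agent $l$'s optimal consumption at capital $k$ in the single-agent problem $\tilde v_l(k)=\max_{0\le x\le f(k)}\{u_l(x)+\alpha_l(x)\tilde v_l(f(k)-x)\}$. It is also assumed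 throughout that $\alpha_i\ge\alpha_j$ at equal consumption levels in the relevant range. Precommitment game $\mathcal{P}$: both players simultaneously commit at time $0$ to consumption sequences, each maximizing $\sum_{t\ge0}\big(\prod_{s=0}^{t-1}\alpha_l(c_s^l)\big)u_l(c_t^l)$ given the other's sequence. Player $i$'s value function $v_i$ (strictly increasing, strictly concave, twice differentiable) satisfies $v_i(k)=\max_{0\le c^i\le f(k)-c^j}\{u_i(c^i)+\alpha_i(c^i)v_i(f(k)-c^i-c^j)\}$ given the other player's consumption $c^j$, and similarly for $j$. Define $$U^i(c^i,c^j,k)=u_i'(c^i)+\alpha_i'(c^i)v_i(f(k)-c^i-c^j),\qquad W^i(c^i,c^j,k)=u_i''(c^i)+\alpha_i''(c^i)v_i(f(k)-c^i-c^j),$$ and $U^j(c^j,c^i,k)$, $W^j(c^j,c^i,k)$ by interchanging $i$ and $j$; the envelope condition is $v_i'(k_t)=U^i(c_t^i,c_t^j,k_t)f'(k_t)$ (and similarly for $j$). Interior equilibria are characterized by $$U^i(c_t^i,c_t^j,k_t)=\alpha_i(c_t^i)U^i(c_{t+1}^i,c_{t+1}^j,k_{t+1})f'(k_{t+1}),$$ $$U^j(c_t^j,c_t^i,k_t)=\alpha_j(c_t^j)U^j(c_{t+1}^j,c_{t+1}^i,k_{t+1})f'(k_{t+1}),$$ $$k_{t+1}=f(k_t)-c_t^i-c_t^j.$$ By the implicit function theorem these conditions define differentiable functions $c_{t+1}^i=F^i(c_t^i,c_t^j,k_t)$, $c_{t+1}^j=F^j(c_t^j,c_t^i,k_t)$,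 $k_{t+1}=F^k(c_t^i,c_t^j,k_t)=f(k_t)-c_t^i-c_t^j$, hence a map $\Phi$ from $X=S^i\times S^j\times K$ into itself, $x_{t+1}=\Phi(x_t)$ with $x_t=(c_t^i,c_t^j,k_t)$. An equilibrium path for $\mathcal{P}$ is a feasible sequence $\{x_t\}_{t\ge0}$ in $X$ with $x_{t+1}=\Phi(x_t)$ for all $t$. A stationary equilibrium $\overline{x}$ is a fixed point of $\Phi$ in $X$; equivalently $\alpha_i(\overline{c}^i)f'(\overline{k})=1$, $\alpha_j(\overline{c}^j)f'(\overline{k})=1$, $\overline{k}=f(\overline{k})-\overline{c}^i-\overline{c}^j$. For $l\in\{i,j\}$, with all functions evaluated at $\overline{x}$, $$\omega_l=\frac{\alpha_l'}{\alpha_l}-\frac{W^l}{U^l}>0,\qquad \delta_l=\frac{\alpha_l'}{\alpha_l}>0,\qquad \eta_l=\frac{\alpha_l'}{\alpha_l}(f'-1)+\frac{f''}{f'}.$$ *)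

theory Defs
  imports "HOL-Analysis.Analysis"
begin

section \<open>Primitives\<close>

definition strictly_concave_on :: "real set \<Rightarrow> (real \<Rightarrow> real) \<Rightarrow> bool" where
  "strictly_concave_on S g \<longleftrightarrow> convex S \<and>
     (\<forall>x\<in>S. \<forall>y\<in>S. \<forall>t. x \<noteq> y \<longrightarrow> 0 < t \<longrightarrow> t < 1 \<longrightarrow>
        (1 - t) * g x + t * g y < g ((1 - t) * x + t * y))"

definition C2_on_open :: "real set \<Rightarrow> (real \<Rightarrow> real) \<Rightarrow> bool" where
  "C2_on_open S g \<longleftrightarrow> open S \<and> g differentiable_on S \<and> deriv g differentiable_on S \<and>
     continuous_on S (deriv (deriv g))"

text \<open>The regularity shared by discount factors, utilities and the production function.
  Functions on the half-line are total functions on the reals of which only the restriction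
  to \<open>{0..}\<close> matters.\<close>

definition smooth_increasing_concave :: "(real \<Rightarrow> real) \<Rightarrow> bool" where
  "smooth_increasing_concave g \<longleftrightarrow>
     continuous_on {0..} g \<and> strict_mono_on {0..} g \<and> strictly_concave_on {0..} g \<and>
     C2_on_open {0<..} g \<and> (\<forall>c>0. deriv (deriv g) c < 0 \<and> 0 < deriv g c)"

definition discount_factor :: "(real \<Rightarrow> real) \<Rightarrow> bool" where
  "discount_factor \<alpha> \<longleftrightarrow> smooth_increasing_concave \<alpha> \<and> 0 < \<alpha> 0 \<and>
     bdd_above (\<alpha> ` {0<..}) \<and> 0 < (SUP c\<in>{0<..}. \<alpha> c) \<and> (SUP c\<in>{0<..}. \<alpha> c) < 1"

definition utility_function :: "(real \<Rightarrow> real) \<Rightarrow> bool" where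
  "utility_function u \<longleftrightarrow> smooth_increasing_concave u \<and> u 0 = 0 \<and>
     filterlim (deriv u) at_top (at_right 0) \<and> (deriv u \<longlongrightarrow> 0) at_top"

text \<open>An agent carries its primitives \<open>disc\<close> and \<open>util\<close>, the value function \<open>solo_val\<close> and the
  optimal consumption policy \<open>solo_cons\<close> of its single-agent problem, and its value function
  \<open>val\<close> in the precommitment game.\<close>

record agent =
  disc :: "real \<Rightarrow> real"
  util :: "real \<Rightarrow> real"
  solo_val :: "real \<Rightarrow> real"
  solo_cons :: "real \<Rightarrow> real"
  val :: "real \<Rightarrow> real"

text \<open>The limit of \<open>deriv f\<close> at \<open>0\<close> may be infinite, hence the extended reals.\<close>

definition production_function :: "(real \<Rightarrow> real) \<Rightarrow> agent \<Rightarrow> agent \<Rightarrow> bool" where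
  "production_function f Ai Aj \<longleftrightarrow> smooth_increasing_concave f \<and> f 0 = 0 \<and>
     (\<exists>L::ereal. ((\<lambda>k. ereal (deriv f k)) \<longlongrightarrow> L) (at_right 0) \<and>
        ereal (max (inverse (disc Ai 0)) (inverse (disc Aj 0))) < L) \<and>
     (\<exists>L::real. (deriv f \<longlongrightarrow> L) at_top \<and> L < 1)"

text \<open>The Bellman equation on \<open>{0..km}\<close> determines the continuous function \<open>solo_val A\<close> uniquely,
  since the discount factor is bounded away from \<open>1\<close> and \<open>f\<close> maps \<open>{0..km}\<close> into itself.\<close>

definition solo_problem :: "(real \<Rightarrow> real) \<Rightarrow> real \<Rightarrow> agent \<Rightarrow> bool" where
  "solo_problem f km A \<longleftrightarrow> continuous_on {0..km} (solo_val A) \<and>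
     (\<forall>k\<in>{0..km}.
        is_arg_max (\<lambda>x. util A x + disc A x * solo_val A (f k - x)) (\<lambda>x. 0 \<le> x \<and> x \<le> f k)
          (solo_cons A k) \<and>
        solo_val A k = util A (solo_cons A k) + disc A (solo_cons A k) * solo_val A (f k - solo_cons A k))"

definition strategy_space :: "real \<Rightarrow> agent \<Rightarrow> real set" where
  "strategy_space km A = {0..solo_cons A km}"

text \<open>Nonnegativity: the value is a supremum of discounted sums of nonnegative utilities.\<close>

definition regular_value_function :: "real \<Rightarrow> (real \<Rightarrow> real) \<Rightarrow> bool" where
  "regular_value_function km v \<longleftrightarrow>
     (\<forall>k\<in>{0..km}. 0 \<le> v k) \<and> strict_mono_on {0..km} v \<and> strictly_concave_on {0..km} v \<and>
     v differentiable_on {0<..<km} \<and> deriv v differentiable_on {0<..<km}"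

definition precommitment_game :: "(real \<Rightarrow> real) \<Rightarrow> real \<Rightarrow> agent \<Rightarrow> agent \<Rightarrow> bool" where
  "precommitment_game f km Ai Aj \<longleftrightarrow>
     (\<forall>A\<in>{Ai, Aj}. discount_factor (disc A) \<and> utility_function (util A) \<and>
        solo_problem f km A \<and> regular_value_function km (val A)) \<and>
     production_function f Ai Aj \<and> 0 < km \<and> f km = km \<and>
     (\<forall>c \<in> strategy_space km Ai \<inter> strategy_space km Aj. disc Aj c \<le> disc Ai c)"

section \<open>Equilibrium dynamics\<close>

text \<open>In \<open>U\<close>, \<open>W\<close> and everything below, \<open>c\<close> is the own consumption of agent \<open>A\<close> and \<open>c'\<close> that
  of the other agent.\<close>

definition U :: "(real \<Rightarrow> real) \<Rightarrow> agent \<Rightarrow> real \<Rightarrow> real \<Rightarrow> real \<Rightarrow> real" where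
  "U f A c c' k = deriv (util A) c + deriv (disc A) c * val A (f k - c - c')"

definition W :: "(real \<Rightarrow> real) \<Rightarrow> agent \<Rightarrow> real \<Rightarrow> real \<Rightarrow> real \<Rightarrow> real" where
  "W f A c c' k = deriv (deriv (util A)) c + deriv (deriv (disc A)) c * val A (f k - c - c')"

text \<open>The Bellman equation of \<open>A\<close> at capital \<open>k\<close>, given the consumption \<open>c'\<close> of the other agent,
  with the maximum attained at \<open>c\<close>. Since \<open>val A\<close> does not depend on \<open>c'\<close>, this cannot be
  required for all \<open>c'\<close>, nor along all paths of the dynamics below; it is meant to be used at a
  stationary equilibrium, where the consumption committed to by the other agent is
  constant.\<close>

definition bellman :: "(real \<Rightarrow> real) \<Rightarrow> agent \<Rightarrow> real \<Rightarrow> real \<Rightarrow> real \<Rightarrow> bool" where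
  "bellman f A c c' k \<longleftrightarrow>
     is_arg_max (\<lambda>y. util A y + disc A y * val A (f k - y - c')) (\<lambda>y. 0 \<le> y \<and> y \<le> f k - c') c \<and>
     val A k = util A c + disc A c * val A (f k - c - c')"

text \<open>A state is \<open>(c\<^sup>i, c\<^sup>j, k)\<close>.\<close>

definition state_space :: "real \<Rightarrow> agent \<Rightarrow> agent \<Rightarrow> (real^3) set" where
  "state_space km Ai Aj =
     {x. x $ 1 \<in> strategy_space km Ai \<and> x $ 2 \<in> strategy_space km Aj \<and> x $ 3 \<in> {0..km}}"

text \<open>The states at which all terms of the equilibrium conditions make sense: the marginal
  utilities are infinite at \<open>0\<close>, and the next capital stock, at which the value functions
  are evaluated, has to be nonnegative.\<close>

definition interior_state :: "(real \<Rightarrow> real) \<Rightarrow> real \<Rightarrow> agent \<Rightarrow> agent \<Rightarrow> real^3 \<Rightarrow> bool" where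
  "interior_state f km Ai Aj x \<longleftrightarrow> x \<in> state_space km Ai Aj \<and>
     0 < x $ 1 \<and> 0 < x $ 2 \<and> 0 < x $ 3 \<and> 0 \<le> f (x $ 3) - x $ 1 - x $ 2"

definition equilibrium_step ::
    "(real \<Rightarrow> real) \<Rightarrow> real \<Rightarrow> agent \<Rightarrow> agent \<Rightarrow> real^3 \<Rightarrow> real^3 \<Rightarrow> bool" where
  "equilibrium_step f km Ai Aj x y \<longleftrightarrow>
     interior_state f km Ai Aj x \<and> interior_state f km Ai Aj y \<and>
     U f Ai (x $ 1) (x $ 2) (x $ 3) =
       disc Ai (x $ 1) * U f Ai (y $ 1) (y $ 2) (y $ 3) * deriv f (y $ 3) \<and>
     U f Aj (x $ 2) (x $ 1) (x $ 3) =
       disc Aj (x $ 2) * U f Aj (y $ 2) (y $ 1) (y $ 3) * deriv f (y $ 3) \<and>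
     y $ 3 = f (x $ 3) - x $ 1 - x $ 2"

text \<open>The map \<open>\<Phi>\<close> cannot be total on the state space (for \<open>k = 0\<close> and positive consumption the
  next capital stock would be negative). It is the partial map given by the
  equilibrium conditions, which have at most one solution by \<open>equilibrium_step_unique\<close> below.\<close>

definition dom_Phi :: "(real \<Rightarrow> real) \<Rightarrow> real \<Rightarrow> agent \<Rightarrow> agent \<Rightarrow> (real^3) set" where
  "dom_Phi f km Ai Aj = {x. \<exists>y. equilibrium_step f km Ai Aj x y}"

definition Phi :: "(real \<Rightarrow> real) \<Rightarrow> real \<Rightarrow> agent \<Rightarrow> agent \<Rightarrow> real^3 \<Rightarrow> real^3" where
  "Phi f km Ai Aj x = (THE y. equilibrium_step f km Ai Aj x y)"

definition equilibrium_path ::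
    "(real \<Rightarrow> real) \<Rightarrow> real \<Rightarrow> agent \<Rightarrow> agent \<Rightarrow> (nat \<Rightarrow> real^3) \<Rightarrow> bool" where
  "equilibrium_path f km Ai Aj x \<longleftrightarrow>
     (\<forall>t. x t \<in> dom_Phi f km Ai Aj \<and> x (Suc t) = Phi f km Ai Aj (x t))"

definition stationary_equilibrium ::
    "(real \<Rightarrow> real) \<Rightarrow> real \<Rightarrow> agent \<Rightarrow> agent \<Rightarrow> real^3 \<Rightarrow> bool" where
  "stationary_equilibrium f km Ai Aj x \<longleftrightarrow>
     x \<in> dom_Phi f km Ai Aj \<and> Phi f km Ai Aj x = x"

definition omega :: "(real \<Rightarrow> real) \<Rightarrow> agent \<Rightarrow> real \<Rightarrow> real \<Rightarrow> real \<Rightarrow> real" where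
  "omega f A c c' k = deriv (disc A) c / disc A c - W f A c c' k / U f A c c' k"

definition delta :: "agent \<Rightarrow> real \<Rightarrow> real" where
  "delta A c = deriv (disc A) c / disc A c"

definition eta :: "(real \<Rightarrow> real) \<Rightarrow> agent \<Rightarrow> real \<Rightarrow> real \<Rightarrow> real" where
  "eta f A c k =
     deriv (disc A) c / disc A c * (deriv f k - 1) + deriv (deriv f) k / deriv f k"

section \<open>The equilibrium conditions determine the next state\<close>

lemma deriv_antimono_pos:
  assumes "smooth_increasing_concave g" "0 < a" "a < b"
  shows "deriv g b < deriv g a"
proof -
  have d: "deriv g differentiable_on {0<..}" and neg: "\<And>c. 0 < c \<Longrightarrow> deriv (deriv g) c < 0"
    using assms(1) by (auto simp: smooth_increasing_concave_def C2_on_open_def)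
  have D: "(deriv g has_real_derivative deriv (deriv g) c) (at c)" if "0 < c" for c
  proof -
    have "deriv g differentiable (at c)"
      using d that by (simp add: differentiable_on_eq_differentiable_at)
    then show ?thesis
      using DERIV_deriv_iff_real_differentiable by blast
  qed
  show ?thesis
    using DERIV_neg_imp_decreasing[OF assms(3), of "deriv g"] D neg assms(2)
    by (meson less_le_trans)
qed

lemma U_strict_decreasing:
  assumes A: "discount_factor (disc A)" "utility_function (util A)"
    and v: "regular_value_function km (val A)"
    and fk: "f k \<le> km" "0 \<le> f k - a' - b'"
    and ab: "0 < a" "0 < b" "a \<le> a'" "a + b \<le> a' + b'" "a < a' \<or> a + b < a' + b'"
  shows "U f A a' b' k < U f A a b k"
proof -
  let ?u = "deriv (util A)" and ?d = "deriv (disc A)"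
  let ?s = "f k - a - b" and ?s' = "f k - a' - b'"
  have su: "smooth_increasing_concave (util A)" and sd: "smooth_increasing_concave (disc A)"
    using A by (auto simp: discount_factor_def utility_function_def)
  have dpos: "0 < ?d a'"
    using sd ab by (auto simp: smooth_increasing_concave_def)
  have s: "?s \<in> {0..km}" "?s' \<in> {0..km}" "?s' \<le> ?s"
    using fk ab by auto
  have v0: "0 \<le> val A ?s" and vm: "?s' < ?s \<Longrightarrow> val A ?s' < val A ?s"
    using v s by (auto simp: regular_value_function_def strict_mono_on_def)
  have vle: "val A ?s' \<le> val A ?s"
    using vm s(3) by (metis order.order_iff_strict)
  have ule: "?u a' \<le> ?u a" and dle: "?d a' \<le> ?d a"
    using deriv_antimono_pos[OF su ab(1), of a'] deriv_antimono_pos[OF sd ab(1), of a'] ab(3)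
    by (auto simp: order.order_iff_strict)
  have 1: "?d a' * val A ?s' \<le> ?d a' * val A ?s"
    using vle dpos by simp
  have 2: "?d a' * val A ?s \<le> ?d a * val A ?s"
    using dle v0 by (rule mult_right_mono)
  show ?thesis
  proof (cases "a < a'")
    case True
    then show ?thesis
      using deriv_antimono_pos[OF su ab(1)] 1 2 by (fastforce simp: U_def)
  next
    case False
    then have "?d a' * val A ?s' < ?d a' * val A ?s"
      using vm ab dpos by simp
    then show ?thesis
      using ule 2 by (simp add: U_def)
  qed
qed

lemma equilibrium_step_unique:
  assumes G: "precommitment_game f km Ai Aj"
    and y: "equilibrium_step f km Ai Aj x y" and z: "equilibrium_step f km Ai Aj x z"
  shows "y = z"
proof -
  have sf: "smooth_increasing_concave f" and km: "f km = km" "0 < km"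
    using G by (auto simp: precommitment_game_def production_function_def)
  have agents: "discount_factor (disc A)" "utility_function (util A)"
    "regular_value_function km (val A)" if "A \<in> {Ai, Aj}" for A
    using G that by (auto simp: precommitment_game_def)
  note ix = y[unfolded equilibrium_step_def, THEN conjunct1, unfolded interior_state_def]
  note iy = y[unfolded equilibrium_step_def, THEN conjunct2, THEN conjunct1,
      unfolded interior_state_def]
  note iz = z[unfolded equilibrium_step_def, THEN conjunct2, THEN conjunct1,
      unfolded interior_state_def]
  have k: "y $ 3 = z $ 3"
    using y z by (simp add: equilibrium_step_def)
  have kb: "0 < y $ 3" "y $ 3 \<le> km"
    using iy by (auto simp: state_space_def)
  have fk: "f (y $ 3) \<le> km"
  proof (cases "y $ 3 = km")
    case False
    then have "f (y $ 3) < f km"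
      using sf kb by (auto simp: smooth_increasing_concave_def strict_mono_on_def)
    then show ?thesis using km by simp
  qed (use km in simp)
  have f'pos: "0 < deriv f (y $ 3)"
    using sf kb by (auto simp: smooth_increasing_concave_def)
  have dpos: "0 < disc A c" if "A \<in> {Ai, Aj}" "0 < c" for A c
  proof -
    have "0 < disc A 0" "disc A 0 < disc A c"
      using agents(1)[OF that(1)] that(2)
      by (auto simp: discount_factor_def smooth_increasing_concave_def strict_mono_on_def)
    then show ?thesis by simp
  qed
  have Ui: "U f Ai (y $ 1) (y $ 2) (y $ 3) = U f Ai (z $ 1) (z $ 2) (y $ 3)"
    using y z k f'pos dpos[of Ai "x $ 1"] ix by (auto simp: equilibrium_step_def)
  have Uj: "U f Aj (y $ 2) (y $ 1) (y $ 3) = U f Aj (z $ 2) (z $ 1) (y $ 3)"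
    using y z k f'pos dpos[of Aj "x $ 2"] ix by (auto simp: equilibrium_step_def)
  have pos: "0 < y $ 1" "0 < y $ 2" "0 < z $ 1" "0 < z $ 2"
    and room: "0 \<le> f (y $ 3) - y $ 1 - y $ 2" "0 \<le> f (y $ 3) - z $ 1 - z $ 2"
    using iy iz k by auto
  have no_i: False if "0 < a" "0 < b" "0 < a'" "0 < b'" "0 \<le> f (y $ 3) - a' - b'"
    "U f Ai a b (y $ 3) = U f Ai a' b' (y $ 3)"
    "a \<le> a'" "a + b \<le> a' + b'" "a < a' \<or> a + b < a' + b'" for a b a' b'
    using U_strict_decreasing[of Ai km f "y $ 3" a' b' a b] agents[of Ai] fk that by simp
  have no_j: False if "0 < a" "0 < b" "0 < a'" "0 < b'" "0 \<le> f (y $ 3) - a' - b'"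
    "U f Aj b a (y $ 3) = U f Aj b' a' (y $ 3)"
    "b \<le> b'" "a + b \<le> a' + b'" "b < b' \<or> a + b < a' + b'" for a b a' b'
    using U_strict_decreasing[of Aj km f "y $ 3" b' a' b a] agents[of Aj] fk that
    by (simp add: add.commute diff_diff_add)
  have "y $ 1 = z $ 1 \<and> y $ 2 = z $ 2"
  proof (rule ccontr)
    assume ne: "\<not> ?thesis"
    consider
        "y $ 1 \<le> z $ 1" "y $ 1 + y $ 2 \<le> z $ 1 + z $ 2"
      | "z $ 1 \<le> y $ 1" "z $ 1 + z $ 2 \<le> y $ 1 + y $ 2"
      | "y $ 2 \<le> z $ 2" "y $ 1 + y $ 2 \<le> z $ 1 + z $ 2"
      | "z $ 2 \<le> y $ 2" "z $ 1 + z $ 2 \<le> y $ 1 + y $ 2"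
      by linarith
    then show False
    proof cases
      case 1 show False
        by (rule no_i[of "y $ 1" "y $ 2" "z $ 1" "z $ 2"]) (use 1 ne pos room Ui in auto)
    next
      case 2 show False
        by (rule no_i[of "z $ 1" "z $ 2" "y $ 1" "y $ 2"]) (use 2 ne pos room Ui in auto)
    next
      case 3 show False
        by (rule no_j[of "y $ 1" "y $ 2" "z $ 1" "z $ 2"]) (use 3 ne pos room Uj in auto)
    next
      case 4 show False
        by (rule no_j[of "z $ 1" "z $ 2" "y $ 1" "y $ 2"]) (use 4 ne pos room Uj in auto)
    qed
  qed
  then show ?thesis
    using k by (simp add: vec_eq_iff forall_3)
qed

lemma Phi_eq_iff:
  assumes "precommitment_game f km Ai Aj" "x \<in> dom_Phi f km Ai Aj"
  shows "Phi f km Ai Aj x = y \<longleftrightarrow> equilibrium_step f km Ai Aj x y"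
proof -
  obtain z where z: "equilibrium_step f km Ai Aj x z"
    using assms(2) by (auto simp: dom_Phi_def)
  have "Phi f km Ai Aj x = z"
    unfolding Phi_def using z equilibrium_step_unique[OF assms(1)] by blast
  then show ?thesis
    using z equilibrium_step_unique[OF assms(1)] by blast
qed

end

theory Submission
  imports Defs
begin

text \<open>Near \<open>xbar\<close> the equilibrium conditions are best read backwards in time. Their linear part then is
  \<open>x = C y\<close>, with \<open>x\<close> and \<open>y\<close> the displacements of the current and the next state, and \<open>C\<close> is a matrix with
  positive entries as soon as \<open>\<eta>\<^sub>i\<close> and \<open>\<eta>\<^sub>j\<close> are negative (\<open>backward_linearization\<close>). Its Perron
  eigenvalue \<open>\<mu>\<close> exceeds \<open>1\<close>, since the first diagonal entry is \<open>1\<close>, and there is a positive left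
  eigenvector \<open>l\<close>. Forwards in time the Perron direction is therefore contracted by the factor \<open>1 / \<mu>\<close>,
  and on the kernel of \<open>l\<close> the dynamics contracts less strongly or not at all (\<open>perron_gap\<close>).

  Such a gap yields a continuously differentiable strong stable curve \<open>\<sigma>\<close>
  (\<open>stable_curve_positive_matrix\<close>): for every small \<open>s\<close> there is an orbit \<open>x\<^sub>t\<close> starting at
  \<open>\<sigma> s\<close>, with \<open>l \<bullet> \<sigma> s = s\<close>, for which \<open>\<theta>\<^sup>-\<^sup>t x\<^sub>t\<close> stays bounded, where \<open>\<theta> < 1\<close> separates the two
  contraction rates. The rescaled orbit is the fixed point of a
  contraction on a Banach space of sequences (\<open>stable_curve_orthogonal\<close>), which makes its dependence on
  \<open>s\<close> smooth (\<open>C1_fixed_point_curve\<close>), and \<open>\<theta> < 1\<close> makes it converge.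

  The map \<open>\<phi>\<close> consists of the first two coordinates of \<open>h - \<sigma> (l \<bullet> h)\<close>, where \<open>h = x - xbar\<close>. This vector
  is in the kernel of \<open>l\<close>, on which these two coordinates are injective, so \<open>\<phi>\<close> vanishes exactly on the curve;
  they also map the kernel of \<open>l\<close> onto the plane, which gives full rank. An equilibrium path that starts on
  the curve must be the constructed orbit, because the conditions have at most one solution for the
  next state (\<open>next_state_unique\<close>).\<close>

section \<open>Fixed points of a contraction under translation\<close>

text \<open>A contraction has a fixed point depending smoothly on a translation parameter: the derivative
  \<open>w' s\<close> solves the fixed point equation \<open>\<xi> = v + N' (w s) \<xi>\<close> obtained by differentiating
  \<open>w s = s v + N (w s)\<close>, which is uniquely solvable because \<open>N' (w s)\<close> has norm at most \<open>\<kappa> < 1\<close>.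
  The same bound absorbs the unknown into the left-hand side of every estimate below, both for the
  remainder of first order and for the modulus of continuity of \<open>w'\<close>.\<close>

lemma C1_fixed_point_curve:
  fixes N :: "'e::banach \<Rightarrow> 'e" and N' :: "'e \<Rightarrow> 'e \<Rightarrow>\<^sub>L 'e"
  assumes \<rho>: "0 < \<rho>" and \<kappa>: "\<kappa> < 1" and N0: "N 0 = 0"
    and der: "\<And>w. w \<in> cball 0 \<rho> \<Longrightarrow> (N has_derivative blinfun_apply (N' w)) (at w within cball 0 \<rho>)"
    and cont: "continuous_on (cball 0 \<rho>) N'"
    and small: "\<And>w. w \<in> cball 0 \<rho> \<Longrightarrow> norm (N' w) \<le> \<kappa>"
  obtains \<delta> w w' where "0 < \<delta>" "w 0 = 0"
    "\<And>s. \<bar>s\<bar> < \<delta> \<Longrightarrow> w s \<in> cball 0 \<rho> \<and> w s = s *\<^sub>R v + N (w s)"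
    "\<And>s. \<bar>s\<bar> < \<delta> \<Longrightarrow> (w has_vector_derivative w' s) (at s)"
    "continuous_on {-\<delta><..<\<delta>} w'"
proof -
  define B where "B = cball (0::'e) \<rho>"
  have \<kappa>0: "0 \<le> \<kappa>"
    using order_trans[OF norm_ge_zero small[of 0]] \<rho> by simp
  have lip: "norm (N a - N b) \<le> \<kappa> * norm (a - b)" if "a \<in> B" "b \<in> B" for a b
    using that der small unfolding B_def
    by (intro differentiable_bound[of "cball 0 \<rho>" N "\<lambda>w. blinfun_apply (N' w)"])
      (auto simp: norm_blinfun.rep_eq[symmetric])
  \<comment> \<open>The translate by \<open>s v\<close> must not push the contraction out of the ball; the \<open>+ 1\<close> covers \<open>v = 0\<close>.\<close>
  define \<delta> where "\<delta> = (1 - \<kappa>) * \<rho> / (norm v + 1)"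
  have \<delta>: "0 < \<delta>" using \<kappa> \<rho> by (simp add: \<delta>_def add_nonneg_pos)
  have sv: "norm (s *\<^sub>R v) \<le> (1 - \<kappa>) * \<rho>" if "\<bar>s\<bar> < \<delta>" for s
  proof -
    have "\<bar>s\<bar> * norm v \<le> \<delta> * (norm v + 1)"
      using that \<delta> by (intro mult_mono) auto
    also have "\<dots> = (1 - \<kappa>) * \<rho>"
      by (smt (verit) \<delta>_def nonzero_eq_divide_eq norm_ge_zero)
    finally show ?thesis by simp
  qed
  have ex: "\<exists>w\<in>B. w = s *\<^sub>R v + N w" if s: "\<bar>s\<bar> < \<delta>" for s
  proof -
    have "\<exists>!w\<in>B. s *\<^sub>R v + N w = w"
    proof (rule Banach_fix[OF _ _ \<kappa>0 \<kappa>])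
      show "complete B" "B \<noteq> {}" using \<rho> by (auto simp: B_def complete_eq_closed)
      show "(\<lambda>w. s *\<^sub>R v + N w) ` B \<subseteq> B"
      proof clarify
        fix w assume w: "w \<in> B"
        have "norm (N w) \<le> \<kappa> * \<rho>"
          using lip[OF w, of 0] w \<rho> N0 \<kappa>0 mult_left_mono[of "norm w" \<rho> \<kappa>] by (auto simp: B_def)
        then have "norm (s *\<^sub>R v + N w) \<le> (1 - \<kappa>) * \<rho> + \<kappa> * \<rho>"
          using sv[OF s] by (intro norm_triangle_le) auto
        then show "s *\<^sub>R v + N w \<in> B" by (simp add: B_def algebra_simps)
      qed
    qed (use lip in \<open>auto simp: dist_norm\<close>)
    then show ?thesis by metis
  qed
  define w where "w s = (SOME w. w \<in> B \<and> w = s *\<^sub>R v + N w)" for s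
  have w: "w s \<in> B" "w s = s *\<^sub>R v + N (w s)" if "\<bar>s\<bar> < \<delta>" for s
    using someI_ex[OF ex[OF that, unfolded Bex_def]] by (auto simp: w_def)
  have fp_unique: "a = b" if "a \<in> B" "b \<in> B" "a = c + N a" "b = c + N b" for a b c
  proof -
    have "norm (a - b) \<le> \<kappa> * norm (a - b)" using lip[OF that(1,2)]
      by (subst that(3), subst that(4)) (simp add: algebra_simps)
    then have "(1 - \<kappa>) * norm (a - b) \<le> 0" by (simp add: algebra_simps)
    then show ?thesis using \<kappa> by (simp add: mult_le_0_iff)
  qed
  have w0: "w 0 = 0"
    using fp_unique[OF w(1)[of 0], of 0 0] w(2)[of 0] \<delta> N0 \<rho> by (simp add: B_def)
  have lin: "\<exists>\<xi>. \<xi> = v + N' a \<xi>" if a: "a \<in> B" for a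
  proof -
    have "\<exists>!\<xi>. v + N' a \<xi> = \<xi>"
    proof (rule banach_fix_type[OF \<kappa>0 \<kappa>], intro allI)
      fix x y
      have "norm (N' a x - N' a y) \<le> norm (N' a) * norm (x - y)"
        by (metis blinfun.diff_right norm_blinfun)
      also have "\<dots> \<le> \<kappa> * norm (x - y)"
        using small a by (intro mult_right_mono) (auto simp: B_def)
      finally show "dist (v + N' a x) (v + N' a y) \<le> \<kappa> * dist x y" by (simp add: dist_norm)
    qed
    then show ?thesis by metis
  qed
  define w' where "w' s = (SOME \<xi>. \<xi> = v + N' (w s) \<xi>)" for s
  have w': "w' s = v + N' (w s) (w' s)" if "\<bar>s\<bar> < \<delta>" for s
    using someI_ex[OF lin[OF w(1)[OF that]]] by (simp add: w'_def)
  have absorb: "(1 - \<kappa>) * norm x \<le> norm (x - N' a x)" if "a \<in> B" for a x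
  proof -
    have "norm (N' a x) \<le> \<kappa> * norm x"
      using order_trans[OF norm_blinfun mult_right_mono[OF small[of a] norm_ge_zero]] that
      by (simp add: B_def)
    then show ?thesis using norm_triangle_ineq2[of x "N' a x"] by (simp add: algebra_simps)
  qed
  have wlip: "(1 - \<kappa>) * norm (w t - w s) \<le> \<bar>t - s\<bar> * norm v" if "\<bar>s\<bar> < \<delta>" "\<bar>t\<bar> < \<delta>" for s t
  proof -
    have "w t - w s = (t - s) *\<^sub>R v + (N (w t) - N (w s))"
      by (subst w(2)[OF that(1)], subst w(2)[OF that(2)]) (simp add: algebra_simps)
    then have "norm (w t - w s) \<le> \<bar>t - s\<bar> * norm v + \<kappa> * norm (w t - w s)"
      using lip[OF w(1)[OF that(2)] w(1)[OF that(1)]]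
      by (metis (no_types, opaque_lifting) add_left_mono norm_scaleR norm_triangle_le)
    then show ?thesis by (simp add: algebra_simps)
  qed
  have wlip': "norm (w t - w s) \<le> norm v / (1 - \<kappa>) * \<bar>t - s\<bar>" if "\<bar>s\<bar> < \<delta>" "\<bar>t\<bar> < \<delta>" for s t
    using wlip[OF that] \<kappa> by (simp add: field_simps)
  have wcont: "continuous_on {-\<delta><..<\<delta>} w"
  proof (rule continuous_onI)
    fix s e :: real assume s: "s \<in> {-\<delta><..<\<delta>}" and e: "0 < e"
    define L where "L = norm v / (1 - \<kappa>)"
    have L: "0 \<le> L" using \<kappa> by (simp add: L_def)
    show "\<exists>d>0. \<forall>t\<in>{-\<delta><..<\<delta>}. dist t s < d \<longrightarrow> dist (w t) (w s) \<le> e"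
    proof (intro exI[of _ "e / (L + 1)"] conjI ballI impI)
      show "0 < e / (L + 1)" using e L by simp
      fix t assume t: "t \<in> {-\<delta><..<\<delta>}" "dist t s < e / (L + 1)"
      have "norm (w t - w s) \<le> L * \<bar>t - s\<bar>" using wlip'[of s t] s t(1) by (auto simp: L_def)
      also have "\<dots> \<le> (L + 1) * \<bar>t - s\<bar>" by (intro mult_right_mono) auto
      also have "\<dots> \<le> e" using t(2) L by (simp add: dist_real_def field_simps)
      finally show "dist (w t) (w s) \<le> e" by (simp add: dist_norm)
    qed
  qed
  have N'w: "continuous_on {-\<delta><..<\<delta>} (\<lambda>s. N' (w s))"
    by (rule continuous_on_compose2[OF cont wcont]) (use w(1) in \<open>auto simp: B_def\<close>)
  show thesis
  proof
    show "0 < \<delta>" "w 0 = 0" by fact+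
    show "w s \<in> cball 0 \<rho> \<and> w s = s *\<^sub>R v + N (w s)" if "\<bar>s\<bar> < \<delta>" for s
      using w[OF that] by (auto simp: B_def)
    show "continuous_on {-\<delta><..<\<delta>} w'"
    proof (clarsimp simp: continuous_on_def)
      fix s :: real assume s: "- \<delta> < s" "s < \<delta>"
      let ?F = "at s within {-\<delta><..<\<delta>}"
      have "((\<lambda>t. norm (N' (w t) - N' (w s)) * norm (w' s) / (1 - \<kappa>)) \<longlongrightarrow>
          norm (N' (w s) - N' (w s)) * norm (w' s) / (1 - \<kappa>)) ?F"
        using N'w s \<kappa> by (intro tendsto_intros) (auto simp: continuous_on_def)
      then have lim: "((\<lambda>t. norm (N' (w t) - N' (w s)) * norm (w' s) / (1 - \<kappa>)) \<longlongrightarrow> 0) ?F" by simp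
      have ev: "\<forall>\<^sub>F t in ?F. norm (w' t - w' s) \<le> norm (N' (w t) - N' (w s)) * norm (w' s) / (1 - \<kappa>)"
        unfolding eventually_at_filter
      proof (intro always_eventually allI impI)
        fix t assume "t \<in> {-\<delta><..<\<delta>}"
        then have t: "\<bar>t\<bar> < \<delta>" and s': "\<bar>s\<bar> < \<delta>" using s by auto
        have "w' t - w' s - N' (w t) (w' t - w' s) = (N' (w t) - N' (w s)) (w' s)"
        proof -
          have "N' (w t) (w' t) = w' t - v" "N' (w s) (w' s) = w' s - v"
            using w'[OF t] w'[OF s'] by (metis add_diff_cancel_left')+
          then show ?thesis by (simp add: blinfun.bilinear_simps)
        qed
        then have "(1 - \<kappa>) * norm (w' t - w' s) \<le> norm (N' (w t) - N' (w s)) * norm (w' s)"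
          using absorb[OF w(1)[OF t], of "w' t - w' s"] norm_blinfun by (metis order_trans)
        then show "norm (w' t - w' s) \<le> norm (N' (w t) - N' (w s)) * norm (w' s) / (1 - \<kappa>)"
          using \<kappa> by (simp add: field_simps)
      qed
      have "((\<lambda>t. w' t - w' s) \<longlongrightarrow> 0) ?F" by (rule Lim_null_comparison[OF ev lim])
      then show "(w' \<longlongrightarrow> w' s) ?F" by (rule LIM_zero_cancel)
    qed
    show "(w has_vector_derivative w' s) (at s)" if "\<bar>s\<bar> < \<delta>" for s
      unfolding has_vector_derivative_def
    proof (rule has_derivativeI_sandwich[where e = "\<delta> - \<bar>s\<bar>"],
        simp_all only: bounded_linear_scaleR_left)
      define M where "M = norm v / (1 - \<kappa>)"
      have ws: "w s \<in> cball 0 \<rho>" using w(1)[OF that] by (simp add: B_def)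
      \<comment> \<open>The quotient \<open>Q\<close> has the value \<open>0\<close> at \<open>w s\<close> itself because of division by zero, so
        the points with \<open>w t = w s\<close> do no harm when the limit is pulled back along \<open>w\<close>.\<close>
      define Q where "Q a = norm (N a - N (w s) - N' (w s) (a - w s)) / norm (a - w s)" for a
      have Q: "(Q \<longlongrightarrow> 0) (at (w s) within B)"
        using der[OF ws] unfolding has_derivative_iff_norm Q_def B_def by auto
      show "0 < \<delta> - \<bar>s\<bar>" using that by simp
      have tw: "(w \<longlongrightarrow> w s) (at s)"
        using wcont that continuous_on_eq_continuous_at[of "{-\<delta><..<\<delta>}" w]
        by (auto simp: isCont_def abs_less_iff)
      have evB: "\<forall>\<^sub>F t in at s. \<bar>t\<bar> < \<delta>"
        unfolding eventually_at using that by (intro exI[of _ "\<delta> - \<bar>s\<bar>"]) (auto simp: dist_real_def)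
      have "((\<lambda>t. Q (w t)) \<longlongrightarrow> 0) (at s)"
      proof (rule tendstoI)
        fix e :: real assume e: "0 < e"
        have "\<forall>\<^sub>F a in at (w s) within B. dist (Q a) 0 < e" using Q e by (rule tendstoD)
        then obtain d where d: "0 < d" "\<And>a. a \<in> B \<Longrightarrow> a \<noteq> w s \<Longrightarrow> dist a (w s) < d \<Longrightarrow> dist (Q a) 0 < e"
          unfolding eventually_at by blast
        have "\<forall>\<^sub>F t in at s. dist (w t) (w s) < d" using tw d(1) by (rule tendstoD)
        with evB show "\<forall>\<^sub>F t in at s. dist (Q (w t)) 0 < e"
        proof eventually_elim
          case (elim t)
          show ?case
          proof (cases "w t = w s")
            case True then show ?thesis using e by (simp add: Q_def)
          next
            case False then show ?thesis using d(2) w(1) elim by blast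
          qed
        qed
      qed
      then have "((\<lambda>t. Q (w t) * M / (1 - \<kappa>)) \<longlongrightarrow> 0 * M / (1 - \<kappa>)) (at s)"
        using \<kappa> by (intro tendsto_intros) auto
      then show "((\<lambda>t. Q (w t) * M / (1 - \<kappa>)) \<longlongrightarrow> 0) (at s)" by simp
      fix t assume "t \<noteq> s" "dist t s < \<delta> - \<bar>s\<bar>"
      then have t: "\<bar>t\<bar> < \<delta>" by (auto simp: dist_real_def)
      let ?x = "w t - w s - (t - s) *\<^sub>R w' s"
      have "?x - N' (w s) ?x = N (w t) - N (w s) - N' (w s) (w t - w s)"
      proof -
        have e: "N' (w s) (w' s) = w' s - v" "N (w t) = w t - t *\<^sub>R v" "N (w s) = w s - s *\<^sub>R v"
          using w'[OF that] w(2)[OF t] w(2)[OF that] by (metis add_diff_cancel_left')+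
        show ?thesis unfolding blinfun.diff_right blinfun.scaleR_right e by (simp add: algebra_simps)
      qed
      then have "(1 - \<kappa>) * norm ?x \<le> Q (w t) * norm (w t - w s)"
        using absorb[OF w(1)[OF that], of ?x] by (cases "w t = w s") (simp_all add: Q_def)
      also have "\<dots> \<le> Q (w t) * (M * \<bar>t - s\<bar>)"
        using wlip'[OF that t] by (intro mult_left_mono) (auto simp: M_def Q_def)
      finally have "norm ?x \<le> Q (w t) * M / (1 - \<kappa>) * \<bar>t - s\<bar>"
        using \<kappa> by (simp add: field_simps)
      then show "norm ?x / norm (t - s) \<le> Q (w t) * M / (1 - \<kappa>)"
        using \<open>t \<noteq> s\<close> by (simp add: divide_le_eq)
    qed
  qed
qed

section \<open>Superposition operators on weighted sequences\<close>

lemma apply_Bcontfun_seq: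
  fixes g :: "nat \<Rightarrow> 'v::real_normed_vector"
  assumes "\<And>t. norm (g t) \<le> b"
  shows "apply_bcontfun (Bcontfun g) = g"
  by (rule Bcontfun_inverse) (use assms in \<open>auto intro!: bcontfun_normI\<close>)

lemma bounded_linear_into_seq:
  fixes G :: "'e::real_normed_vector \<Rightarrow> nat \<Rightarrow> 'v::real_normed_vector"
  assumes lin: "\<And>t. linear (\<lambda>x. G x t)" and bound: "\<And>x t. norm (G x t) \<le> b * norm x"
  shows "bounded_linear (\<lambda>x. Bcontfun (G x))"
    and "apply_bcontfun (Bcontfun (G x)) = G x"
    and "norm (Bcontfun (G x)) \<le> b * norm x"
proof -
  have app: "apply_bcontfun (Bcontfun (G x)) = G x" for x
    using bound by (rule apply_Bcontfun_seq)
  then show "apply_bcontfun (Bcontfun (G x)) = G x" .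
  have nb: "norm (Bcontfun (G x)) \<le> b * norm x" for x
    using bound by (intro norm_bound) (simp add: app)
  then show "norm (Bcontfun (G x)) \<le> b * norm x" .
  show "bounded_linear (\<lambda>x. Bcontfun (G x))"
  proof (rule bounded_linear_intro)
    show "Bcontfun (G (x + y)) = Bcontfun (G x) + Bcontfun (G y)" for x y
      by (rule bcontfun_eqI) (simp add: app linear_add[OF lin])
    show "Bcontfun (G (c *\<^sub>R x)) = c *\<^sub>R Bcontfun (G x)" for c x
      by (rule bcontfun_eqI) (simp add: app linear_scale[OF lin])
    show "norm (Bcontfun (G x)) \<le> norm x * b" for x
      using nb[of x] by (simp add: mult.commute)
  qed
qed

text \<open>Uniform limits of continuous functions on any topological space are continuous. The instance is
  applied to the discrete space of natural numbers, where it says that bounded sequences in a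
  Banach space form a Banach space.\<close>

instance bcontfun :: (topological_space, complete_space) complete_space
proof
  fix f :: "nat \<Rightarrow> ('a, 'b) bcontfun"
  assume "Cauchy f"
  then have "uniformly_Cauchy_on UNIV (\<lambda>n. apply_bcontfun (f n))"
    unfolding uniformly_Cauchy_on_def Cauchy_def by (meson dist_fun_lt_imp_dist_val_lt)
  then obtain g where "uniform_limit UNIV (\<lambda>n. apply_bcontfun (f n)) g sequentially"
    using Cauchy_uniformly_convergent unfolding uniformly_convergent_on_def by blast
  then show "convergent f"
    by (metis uniform_limit_bcontfunE sequentially_bot convergentI)
qed

instance bcontfun :: (topological_space, banach) banach ..

text \<open>Orbits are sought in the form \<open>\<theta>\<^sup>t x\<^sub>t\<close> with a bounded sequence \<open>x\<close>; this is a pair of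
  consecutive states of such an orbit.\<close>

definition orbit_pair :: "real \<Rightarrow> nat \<Rightarrow> (nat \<Rightarrow>\<^sub>C 'v) \<Rightarrow> 'v \<times> 'v::real_normed_vector" where
  "orbit_pair \<theta> t x = (\<theta> ^ t *\<^sub>R apply_bcontfun x t, \<theta> ^ Suc t *\<^sub>R apply_bcontfun x (Suc t))"

text \<open>A nonlinear remainder \<open>R\<close> in the recursion for the orbit turns into this operator on the rescaled
  sequences. The next definition is its candidate for the derivative, taken entrywise.\<close>

definition superposition ::
    "real \<Rightarrow> ('v \<times> 'v \<Rightarrow> 'v) \<Rightarrow> (nat \<Rightarrow>\<^sub>C 'v) \<Rightarrow> (nat \<Rightarrow>\<^sub>C 'v::real_normed_vector)" where
  "superposition \<theta> R x = Bcontfun (\<lambda>t. (1 / \<theta> ^ t) *\<^sub>R R (orbit_pair \<theta> t x))"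

definition superposition_deriv ::
    "real \<Rightarrow> ('v \<times> 'v \<Rightarrow> ('v \<times> 'v) \<Rightarrow>\<^sub>L 'v) \<Rightarrow> (nat \<Rightarrow>\<^sub>C 'v) \<Rightarrow>
     (nat \<Rightarrow>\<^sub>C 'v) \<Rightarrow>\<^sub>L (nat \<Rightarrow>\<^sub>C 'v::real_normed_vector)" where
  "superposition_deriv \<theta> R' x = Blinfun (\<lambda>h. Bcontfun (\<lambda>t.
     (1 / \<theta> ^ t) *\<^sub>R blinfun_apply (R' (orbit_pair \<theta> t x)) (orbit_pair \<theta> t h)))"

text \<open>Differentiability of a superposition operator in the supremum norm needs estimates that are uniform
  in \<open>t\<close>. They hold because \<open>\<theta> \<le> 1\<close> keeps all pairs in one compact ball, on which \<open>R'\<close> is uniformly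
  continuous, and because the factor \<open>\<theta>\<^sup>t\<close> in the pairs cancels the factor \<open>\<theta>\<^sup>-\<^sup>t\<close> in front.\<close>

lemma superposition_C1:
  fixes R :: "'v::euclidean_space \<times> 'v \<Rightarrow> 'v" and R' :: "'v \<times> 'v \<Rightarrow> ('v \<times> 'v) \<Rightarrow>\<^sub>L 'v"
    and \<theta> r \<epsilon> :: real
  assumes \<theta>: "0 < \<theta>" "\<theta> \<le> 1" and R0: "R 0 = 0" and r: "0 < r"
    and der: "\<And>p. p \<in> cball 0 r \<Longrightarrow> (R has_derivative blinfun_apply (R' p)) (at p within cball 0 r)"
    and cont: "continuous_on (cball 0 r) R'"
    and small: "\<And>p. p \<in> cball 0 r \<Longrightarrow> norm (R' p) \<le> \<epsilon>"
  shows "\<And>(x :: nat \<Rightarrow>\<^sub>C 'v) t. x \<in> cball 0 (r / 2) \<Longrightarrow> norm (orbit_pair \<theta> t x) \<le> r"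
    and "\<And>x. x \<in> cball 0 (r / 2) \<Longrightarrow>
          apply_bcontfun (superposition \<theta> R x) = (\<lambda>t. (1 / \<theta> ^ t) *\<^sub>R R (orbit_pair \<theta> t x))"
    and "\<And>x. x \<in> cball 0 (r / 2) \<Longrightarrow>
          (superposition \<theta> R has_derivative blinfun_apply (superposition_deriv \<theta> R' x))
            (at x within cball 0 (r / 2))"
    and "\<And>x. x \<in> cball 0 (r / 2) \<Longrightarrow> norm (superposition_deriv \<theta> R' x) \<le> 2 * \<epsilon>"
    and "continuous_on (cball 0 (r / 2)) (superposition_deriv \<theta> R')"
proof -
  define B where "B = cball (0 :: nat \<Rightarrow>\<^sub>C 'v) (r / 2)"
  define P where P_eq: "P = (orbit_pair \<theta> :: nat \<Rightarrow> (nat \<Rightarrow>\<^sub>C 'v) \<Rightarrow> 'v \<times> 'v)"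
  have P_def: "P t x = (\<theta> ^ t *\<^sub>R apply_bcontfun x t, \<theta> ^ Suc t *\<^sub>R apply_bcontfun x (Suc t))" for t x
    by (simp add: P_eq orbit_pair_def)
  define NR where NR_eq: "NR = superposition \<theta> R"
  have NR_def: "NR x = Bcontfun (\<lambda>t. (1 / \<theta> ^ t) *\<^sub>R R (P t x))" for x
    by (simp add: NR_eq superposition_def P_eq)
  define NR' where NR'_eq: "NR' = superposition_deriv \<theta> R'"
  have NR'_def: "NR' x = Blinfun (\<lambda>h. Bcontfun (\<lambda>t. (1 / \<theta> ^ t) *\<^sub>R R' (P t x) (P t h)))" for x
    by (simp add: NR'_eq superposition_deriv_def P_eq)
  have Plin: "linear (P t)" for t
    by (auto simp: P_def linear_iff algebra_simps)
  have Pn: "norm (P t x) \<le> \<theta> ^ t * (2 * norm x)" for t x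
  proof -
    have "norm (P t x) \<le> \<theta> ^ t * norm (x t) + \<theta> ^ Suc t * norm (x (Suc t))"
      unfolding P_def using \<theta> by (intro order_trans[OF norm_Pair_le]) auto
    also have "\<dots> \<le> \<theta> ^ t * norm x + \<theta> ^ t * norm x"
      using \<theta> by (intro add_mono mult_mono norm_bounded) (auto simp: mult_le_cancel_right1)
    finally show ?thesis by (simp add: mult.commute mult.left_commute)
  qed
  have \<theta>t: "0 < \<theta> ^ t" "\<theta> ^ t \<le> 1" for t using \<theta> by (auto simp: power_le_one)
  have Pr: "norm (P t x) \<le> r" if "x \<in> B" for t x
  proof -
    have "\<theta> ^ t * (2 * norm x) \<le> 1 * r"
      using that \<theta>t[of t] r by (intro mult_mono) (auto simp: B_def)
    then show ?thesis using Pn[of t x] by simp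
  qed
  have unscale: "norm ((1 / \<theta> ^ t) *\<^sub>R y) \<le> b" if "norm y \<le> \<theta> ^ t * b" for t b and y :: 'v
    using that \<theta>t[of t] by (simp add: field_simps)
  have \<epsilon>0: "0 \<le> \<epsilon>" using order_trans[OF norm_ge_zero small[of 0]] r by simp
  have Rlip: "norm (R p - R q) \<le> \<epsilon> * norm (p - q)" if "p \<in> cball 0 r" "q \<in> cball 0 r" for p q
    using that der small
    by (intro differentiable_bound[of "cball 0 r" R "\<lambda>w. blinfun_apply (R' w)"])
      (auto simp: norm_blinfun.rep_eq[symmetric])
  have NRb: "norm ((1 / \<theta> ^ t) *\<^sub>R R (P t x)) \<le> \<epsilon> * (2 * norm x)" if "x \<in> B" for t x
  proof (rule unscale)
    have "norm (R (P t x)) \<le> \<epsilon> * norm (P t x)"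
      using Rlip[of "P t x" 0] Pr[OF that, of t] R0 r by simp
    also have "\<dots> \<le> \<epsilon> * (\<theta> ^ t * (2 * norm x))" using Pn \<epsilon>0 by (intro mult_left_mono) auto
    finally show "norm (R (P t x)) \<le> \<theta> ^ t * (\<epsilon> * (2 * norm x))" by (simp add: algebra_simps)
  qed
  have NR: "apply_bcontfun (NR x) = (\<lambda>t. (1 / \<theta> ^ t) *\<^sub>R R (P t x))" if "x \<in> B" for x
    unfolding NR_def by (rule apply_Bcontfun_seq[OF NRb[OF that]])
  have fam_lin: "linear (\<lambda>h. (1 / \<theta> ^ t) *\<^sub>R A (P t h))" for t and A :: "('v \<times> 'v) \<Rightarrow>\<^sub>L 'v"
    using Plin[of t] by (auto simp: linear_iff blinfun.bilinear_simps scaleR_right_distrib)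
  have fam_bound: "norm ((1 / \<theta> ^ t) *\<^sub>R A (P t h)) \<le> (2 * b) * norm h"
    if "norm A \<le> b" for t b h and A :: "('v \<times> 'v) \<Rightarrow>\<^sub>L 'v"
  proof (rule unscale)
    have "norm (A (P t h)) \<le> norm A * norm (P t h)" by (rule norm_blinfun)
    also have "\<dots> \<le> b * (\<theta> ^ t * (2 * norm h))"
      using that Pn by (intro mult_mono) (auto intro: order_trans[OF norm_ge_zero])
    finally show "norm (A (P t h)) \<le> \<theta> ^ t * (2 * b * norm h)" by (simp add: algebra_simps)
  qed
  note N' = bounded_linear_into_seq[where G = "\<lambda>h t. (1 / \<theta> ^ t) *\<^sub>R blinfun_apply (R' (P t x)) (P t h)" and b = "2 * \<epsilon>" for x,
      OF fam_lin fam_bound[OF small]]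
  have NR'b: "bounded_linear (\<lambda>h. Bcontfun (\<lambda>t. (1 / \<theta> ^ t) *\<^sub>R blinfun_apply (R' (P t x)) (P t h)))"
    and NR'a: "apply_bcontfun (Bcontfun (\<lambda>t. (1 / \<theta> ^ t) *\<^sub>R blinfun_apply (R' (P t x)) (P t h)))
      = (\<lambda>t. (1 / \<theta> ^ t) *\<^sub>R blinfun_apply (R' (P t x)) (P t h))"
    and NR'n: "norm (Bcontfun (\<lambda>t. (1 / \<theta> ^ t) *\<^sub>R blinfun_apply (R' (P t x)) (P t h))) \<le> 2 * \<epsilon> * norm h"
    if "x \<in> B" for x h
    using Pr[OF that] by (auto intro!: N')
  have NR': "apply_bcontfun (NR' x h) = (\<lambda>t. (1 / \<theta> ^ t) *\<^sub>R blinfun_apply (R' (P t x)) (P t h))"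
    if "x \<in> B" for x h
    by (simp add: NR'_def bounded_linear_Blinfun_apply[OF NR'b[OF that]] NR'a[OF that])
  have NR'nb: "norm (NR' x) \<le> 2 * \<epsilon>" if "x \<in> B" for x
    using NR'n[OF that] \<epsilon>0
    by (intro norm_blinfun_bound) (auto simp: NR'_def bounded_linear_Blinfun_apply[OF NR'b[OF that]])
  have unif: "\<exists>d>0. \<forall>p\<in>cball 0 r. \<forall>q\<in>cball 0 r. dist q p < d \<longrightarrow> norm (R' q - R' p) \<le> e" if "0 < e" for e
    using compact_uniformly_continuous[OF cont compact_cball] that
    unfolding uniformly_continuous_on_def dist_norm by (meson less_imp_le)
  have Pd: "dist (P t y) (P t x) \<le> \<theta> ^ t * (2 * norm (y - x))" for t x y
    using Pn[of t "y - x"] by (simp add: dist_norm linear_diff[OF Plin])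
  have Pd': "dist (P t y) (P t x) < d" if "norm (y - x) < d / 2" for t x y d
  proof -
    have "\<theta> ^ t * (2 * norm (y - x)) \<le> 1 * (2 * norm (y - x))"
      using \<theta>t[of t] by (intro mult_right_mono) auto
    then show ?thesis using Pd[of t y x] that by simp
  qed
  note abbr_eqs = P_eq[symmetric] NR_eq[symmetric] NR'_eq[symmetric]
  show "norm (orbit_pair \<theta> t x) \<le> r" if "x \<in> cball 0 (r / 2)" for t and x :: "nat \<Rightarrow>\<^sub>C 'v"
    unfolding abbr_eqs using Pr that by (simp add: B_def)
  show "apply_bcontfun (superposition \<theta> R x) = (\<lambda>t. (1 / \<theta> ^ t) *\<^sub>R R (orbit_pair \<theta> t x))"
    if "x \<in> cball 0 (r / 2)" for x
    unfolding abbr_eqs using NR that by (simp add: B_def)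
  show "norm (superposition_deriv \<theta> R' x) \<le> 2 * \<epsilon>" if "x \<in> cball 0 (r / 2)" for x
    unfolding abbr_eqs using NR'nb that by (simp add: B_def)
  show "continuous_on (cball 0 (r / 2)) (superposition_deriv \<theta> R')"
    unfolding abbr_eqs B_def[symmetric]
  proof (rule continuous_onI)
    fix x and e :: real assume x: "x \<in> B" and e: "0 < e"
    obtain d where d: "0 < d" "\<And>p q. p \<in> cball 0 r \<Longrightarrow> q \<in> cball 0 r \<Longrightarrow> dist q p < d \<Longrightarrow> norm (R' q - R' p) \<le> e / 2"
      using unif[of "e / 2"] e by auto
    show "\<exists>d>0. \<forall>y\<in>B. dist y x < d \<longrightarrow> dist (NR' y) (NR' x) \<le> e"
    proof (intro exI[of _ "d / 2"] conjI ballI impI)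
      show "0 < d / 2" using d by simp
      fix y assume y: "y \<in> B" "dist y x < d / 2"
      have "norm (R' (P t y) - R' (P t x)) \<le> e / 2" for t
        using Pr[OF x, of t] Pr[OF y(1), of t] y(2) Pd' by (intro d(2)) (auto simp: dist_norm)
      then have "norm ((NR' y - NR' x) h) \<le> e * norm h" for h
        using fam_bound[of "R' (P t y) - R' (P t x)" "e / 2" t h for t] x y
        by (intro norm_bound) (simp add: blinfun.diff_left NR' scaleR_diff_right del: norm_scaleR)
      then show "dist (NR' y) (NR' x) \<le> e"
        using e by (auto simp: dist_norm intro: norm_blinfun_bound)
    qed
  qed
  show "(superposition \<theta> R has_derivative blinfun_apply (superposition_deriv \<theta> R' x))
      (at x within cball 0 (r / 2))" if "x \<in> cball 0 (r / 2)" for x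
    unfolding abbr_eqs has_derivative_within_alt2 B_def[symmetric]
  proof (intro conjI allI impI blinfun.bounded_linear_right)
    have x: "x \<in> B" using that by (simp add: B_def)
    fix e :: real assume e: "0 < e"
    obtain d where d: "0 < d" "\<And>p q. p \<in> cball 0 r \<Longrightarrow> q \<in> cball 0 r \<Longrightarrow> dist q p < d \<Longrightarrow> norm (R' q - R' p) \<le> e / 2"
      using unif[of "e / 2"] e by auto
    show "\<forall>\<^sub>F y in at x within B. norm (NR y - NR x - NR' x (y - x)) \<le> e * norm (y - x)"
      unfolding eventually_at
    proof (intro exI[of _ "d / 2"] conjI ballI impI)
      show "0 < d / 2" using d by simp
      fix y assume y: "y \<in> B" "y \<noteq> x \<and> dist y x < d / 2"
      show "norm (NR y - NR x - NR' x (y - x)) \<le> e * norm (y - x)"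
      proof (rule norm_bound)
        fix t
        let ?p = "P t x" and ?q = "P t y"
        let ?S = "cball 0 r \<inter> ball ?p d"
        have pq: "?p \<in> ?S" "?q \<in> ?S"
          using Pr[OF x, of t] Pr[OF y(1), of t] d(1) Pd'[of y x d t] y(2)
          by (auto simp: dist_norm norm_minus_commute)
        \<comment> \<open>On the convex set \<open>?S\<close> the derivative of \<open>R\<close> differs from its value at \<open>?p\<close> by at most \<open>e / 2\<close>.\<close>
        have "norm (R ?q - R ?p - R' ?p (?q - ?p)) \<le> norm (?q - ?p) * (e / 2)"
        proof (rule differentiable_bound_linearization[where S = ?S and f' = "\<lambda>p. blinfun_apply (R' p)"])
          show "?p \<in> ?S" by (rule pq)
          show "?p + u *\<^sub>R (?q - ?p) \<in> ?S" if "u \<in> {0..1}" for u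
          proof -
            have "(1 - u) *\<^sub>R ?p + u *\<^sub>R ?q \<in> ?S"
              by (rule convexD_alt) (use that pq in \<open>auto intro: convex_Int\<close>)
            then show ?thesis by (simp add: algebra_simps)
          qed
          show "(R has_derivative R' p) (at p within ?S)" if "p \<in> ?S" for p
            using that by (auto intro: has_derivative_subset[OF der])
          show "onorm (blinfun_apply (R' p) - blinfun_apply (R' ?p)) \<le> e / 2" if "p \<in> ?S" for p
            using d(2)[of ?p p] that pq
            by (simp add: norm_blinfun.rep_eq fun_diff_def minus_blinfun.rep_eq dist_commute)
        qed
        also have "\<dots> \<le> (\<theta> ^ t * (2 * norm (y - x))) * (e / 2)"
          using Pd[of t y x] e by (intro mult_right_mono) (auto simp: dist_norm)
        finally have "norm ((1 / \<theta> ^ t) *\<^sub>R (R ?q - R ?p - R' ?p (?q - ?p))) \<le> e * norm (y - x)"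
          by (intro unscale) (simp add: algebra_simps)
        then show "norm (apply_bcontfun (NR y - NR x - NR' x (y - x)) t) \<le> e * norm (y - x)"
          by (simp add: NR[OF x] NR[OF y(1)] NR'[OF x] linear_diff[OF Plin] algebra_simps del: norm_scaleR)
      qed
    qed
  qed
qed

section \<open>Strong stable curves\<close>

lemma norm_diff_projection_le:
  fixes e z :: "'v::real_inner"
  assumes "norm e = 1"
  shows "norm (z - (z \<bullet> e) *\<^sub>R e) \<le> norm z"
proof -
  have "(norm (z - (z \<bullet> e) *\<^sub>R e))\<^sup>2 = (norm z)\<^sup>2 - (z \<bullet> e)\<^sup>2"
    using assms unfolding power2_norm_eq_inner
    by (simp add: inner_diff_left inner_diff_right inner_commute[of e z] power2_eq_square norm_eq_1)
  then have "(norm (z - (z \<bullet> e) *\<^sub>R e))\<^sup>2 \<le> (norm z)\<^sup>2" by simp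
  then show ?thesis using power2_le_imp_le norm_ge_zero by blast
qed

text \<open>The Lyapunov-Perron construction for the recursion \<open>x\<^sub>t = C x\<^sub>t\<^sub>+\<^sub>1 + R (x\<^sub>t, x\<^sub>t\<^sub>+\<^sub>1)\<close>, which runs
  backwards in time. Passing to the next state divides the component along \<open>e\<close> by about \<open>\<mu> > 1\<close>, and
  no other direction is contracted that strongly. With \<open>1 / \<mu> < \<theta> < 1\<close> and \<open>\<theta> \<nu> < 1\<close>, the rescaled
  states \<open>\<theta>\<^sup>-\<^sup>t x\<^sub>t = y\<^sub>t e + z\<^sub>t\<close>, \<open>z\<^sub>t\<close> orthogonal to \<open>e\<close>, satisfy
  \<open>y\<^sub>t\<^sub>+\<^sub>1 = (y\<^sub>t - q\<^sub>t \<bullet> e) / (\<theta> \<mu>)\<close> with \<open>y\<^sub>0 = s\<close>, solved forwards, and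
  \<open>z\<^sub>t = \<theta> C z\<^sub>t\<^sub>+\<^sub>1 + (q\<^sub>t - (q\<^sub>t \<bullet> e) e)\<close>, solved backwards, where \<open>q\<^sub>t\<close> comes from \<open>R\<close>. Both
  linear parts are contractions of the spaces of bounded sequences, and a small remainder \<open>R\<close> does not
  destroy this. Since \<open>\<theta> < 1\<close>, a bounded solution belongs to an orbit that converges to \<open>0\<close>. The curve
  \<open>\<sigma>\<close> collects the initial states of these orbits. It is a strong stable manifold: \<open>\<nu>\<close> may lie
  on either side of \<open>1\<close>.\<close>

theorem stable_curve_orthogonal:
  fixes C :: "'v::euclidean_space \<Rightarrow> 'v" and R :: "'v \<times> 'v \<Rightarrow> 'v"
    and R' :: "'v \<times> 'v \<Rightarrow> ('v \<times> 'v) \<Rightarrow>\<^sub>L 'v"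
  assumes C: "linear C" and e: "norm e = 1" and Ce: "C e = \<mu> *\<^sub>R e"
    and Ce': "\<And>x. C x \<bullet> e = \<mu> * (x \<bullet> e)"
    and C\<nu>: "\<And>z. z \<bullet> e = 0 \<Longrightarrow> norm (C z) \<le> \<nu> * norm z"
    and \<mu>: "1 < \<mu>" "0 \<le> \<nu>" "\<nu> < \<mu>"
    and S: "open S" "0 \<in> S"
    and der: "\<And>p. p \<in> S \<Longrightarrow> (R has_derivative blinfun_apply (R' p)) (at p)"
    and cont: "continuous_on S R'" and R0: "R 0 = 0" and R'0: "R' 0 = 0" and \<eta>: "0 < \<eta>"
  obtains \<delta> \<sigma> \<sigma>' where "0 < \<delta>" "\<sigma> 0 = 0" "continuous_on {-\<delta><..<\<delta>} \<sigma>'"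
    "\<And>s. \<bar>s\<bar> < \<delta> \<Longrightarrow> \<sigma> s \<bullet> e = s"
    "\<And>s. \<bar>s\<bar> < \<delta> \<Longrightarrow> (\<sigma> has_vector_derivative \<sigma>' s) (at s)"
    "\<And>s. \<bar>s\<bar> < \<delta> \<Longrightarrow> \<exists>x :: nat \<Rightarrow> 'v. x 0 = \<sigma> s \<and> (\<forall>t. norm (x t) \<le> \<eta>) \<and>
        (\<forall>t. x t = C (x (Suc t)) + R (x t, x (Suc t))) \<and> x \<longlonglongrightarrow> 0"
proof -
  \<comment> \<open>The geometric mean of \<open>1 / \<mu>\<close> and the smaller of \<open>1\<close> and \<open>1 / \<nu>\<close> lies strictly between the two.\<close>
  define \<theta> where "\<theta> = 1 / sqrt (\<mu> * max 1 \<nu>)"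
  have m1: "1 < \<mu> * max 1 \<nu>" using \<mu> by (smt (verit) mult_le_cancel_left1)
  have \<theta>: "0 < \<theta>" "\<theta> < 1"
    using m1 by (auto simp: \<theta>_def)
  have \<theta>2: "\<theta>\<^sup>2 * (\<mu> * max 1 \<nu>) = 1" using m1 \<mu> by (auto simp: \<theta>_def power_divide)
  have \<theta>\<mu>: "1 < \<theta> * \<mu>"
  proof (rule power2_less_imp_less[of 1 "\<theta> * \<mu>"])
    have "1 < \<theta>\<^sup>2 * (\<mu> * \<mu>)"
      using \<theta>2 mult_strict_left_mono[of "\<mu> * max 1 \<nu>" "\<mu> * \<mu>" "\<theta>\<^sup>2"] \<mu> \<theta> by simp
    then show "1\<^sup>2 < (\<theta> * \<mu>)\<^sup>2" by (simp add: power2_eq_square algebra_simps)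
  qed (use \<theta> \<mu> in auto)
  have \<theta>\<nu>: "\<theta> * \<nu> < 1"
  proof (rule power2_less_imp_less[of "\<theta> * \<nu>" 1])
    have "\<nu> * \<nu> < \<mu> * max 1 \<nu>"
      using mult_left_mono[of \<nu> "max 1 \<nu>" \<nu>] mult_strict_right_mono[of \<nu> \<mu> "max 1 \<nu>"] \<mu> by linarith
    then have "\<theta>\<^sup>2 * (\<nu> * \<nu>) < 1" using \<theta>2 \<theta> mult_strict_left_mono[of "\<nu> * \<nu>" "\<mu> * max 1 \<nu>" "\<theta>\<^sup>2"] by simp
    then show "(\<theta> * \<nu>)\<^sup>2 < 1\<^sup>2" by (simp add: power2_eq_square algebra_simps)
  qed simp
  define a where "a = 1 / (\<theta> * \<mu>)"
  have a: "0 < a" "a < 1" using \<theta>\<mu> by (auto simp: a_def)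
  define \<kappa> where "\<kappa> = max a (\<theta> * \<nu>)"
  have \<kappa>: "0 < \<kappa>" "\<kappa> < 1" using a \<theta>\<nu> by (auto simp: \<kappa>_def)
  \<comment> \<open>The remainder enters through maps of norm at most \<open>2\<close> before and after an operator of norm at most
    \<open>2 \<epsilon>\<close>; the total contribution \<open>8 \<epsilon>\<close> uses up half of the gap between \<open>\<kappa>\<close> and \<open>1\<close>.\<close>
  define \<epsilon> where "\<epsilon> = (1 - \<kappa>) / 16"
  have \<epsilon>: "0 < \<epsilon>" using \<kappa> by (simp add: \<epsilon>_def)
  obtain r where r: "0 < r" "r \<le> \<eta>" "cball 0 r \<subseteq> S" "\<And>p. p \<in> cball 0 r \<Longrightarrow> norm (R' p) \<le> \<epsilon>"
  proof -
    obtain r1 where r1: "0 < r1" "cball 0 r1 \<subseteq> S" using S open_contains_cball by blast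
    obtain d where d: "0 < d" "\<And>p. p \<in> S \<Longrightarrow> dist p 0 < d \<Longrightarrow> dist (R' p) (R' 0) < \<epsilon>"
      using cont S \<epsilon> unfolding continuous_on_iff by meson
    show thesis
    proof (rule that[of "min (min r1 \<eta>) (d / 2)"])
      show "norm (R' p) \<le> \<epsilon>" if "p \<in> cball 0 (min (min r1 \<eta>) (d / 2))" for p
      proof -
        have "p \<in> S" using that by (intro subsetD[OF r1(2)]) simp
        then show ?thesis using d(2)[of p] that d(1) R'0 by simp
      qed
    qed (use r1 d \<eta> in auto)
  qed
  define P where "P = (orbit_pair \<theta> :: nat \<Rightarrow> (nat \<Rightarrow>\<^sub>C 'v) \<Rightarrow> 'v \<times> 'v)"
  have P: "P t x = (\<theta> ^ t *\<^sub>R apply_bcontfun x t, \<theta> ^ Suc t *\<^sub>R apply_bcontfun x (Suc t))" for t x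
    by (simp add: P_def orbit_pair_def)
  define NR where "NR = superposition \<theta> R"
  define NR' where "NR' = superposition_deriv \<theta> R'"
  have derB: "(R has_derivative blinfun_apply (R' p)) (at p within cball 0 r)" if "p \<in> cball 0 r" for p
    using der that r(3) by (blast intro: has_derivative_at_withinI)
  note W = superposition_C1[where \<theta> = \<theta> and R = R and R' = R' and r = r and \<epsilon> = \<epsilon>,
      OF \<theta>(1) less_imp_le[OF \<theta>(2)] R0 r(1) _ continuous_on_subset[OF cont r(3)], OF derB r(4)]
  have Wr: "norm (P t x) \<le> r" if "x \<in> cball 0 (r / 2)" for t x
    unfolding P_def by (rule W(1); (assumption | fact that))
  have WN: "apply_bcontfun (NR x) = (\<lambda>t. (1 / \<theta> ^ t) *\<^sub>R R (P t x))" if "x \<in> cball 0 (r / 2)" for x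
    unfolding P_def NR_def by (rule W(2); (assumption | fact that))
  have WN': "(NR has_derivative blinfun_apply (NR' x)) (at x within cball 0 (r / 2))"
    if "x \<in> cball 0 (r / 2)" for x
    unfolding NR_def NR'_def by (rule W(3); (assumption | fact that))
  have Wn: "norm (NR' x) \<le> 2 * \<epsilon>" if "x \<in> cball 0 (r / 2)" for x
    unfolding NR'_def by (rule W(4); (assumption | fact that))
  have Wc: "continuous_on (cball 0 (r / 2)) NR'"
    unfolding NR'_def by (rule W(5); assumption)

  \<comment> \<open>A pair of sequences \<open>(y, z)\<close> encodes the rescaled orbit \<open>y\<^sub>t e + z\<^sub>t\<close>. Orthogonality of \<open>z\<^sub>t\<close> to \<open>e\<close>
    is not imposed; it holds at the fixed point since \<open>L2\<close> and \<open>J2\<close> project.\<close>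
  define X where "X w = Bcontfun (\<lambda>t. apply_bcontfun (fst w) t *\<^sub>R e + apply_bcontfun (snd w) t)"
    for w :: "(nat \<Rightarrow>\<^sub>C real) \<times> (nat \<Rightarrow>\<^sub>C 'v)"
  have Xb: "norm (apply_bcontfun (fst w) t *\<^sub>R e + apply_bcontfun (snd w) t) \<le> 2 * norm w"
    for t and w :: "(nat \<Rightarrow>\<^sub>C real) \<times> (nat \<Rightarrow>\<^sub>C 'v)"
  proof -
    have "norm (apply_bcontfun (fst w) t *\<^sub>R e + apply_bcontfun (snd w) t) \<le> norm (fst w) + norm (snd w)"
      using norm_bounded[of "fst w" t] norm_bounded[of "snd w" t] e by (intro norm_triangle_le) simp
    then show ?thesis using norm_fst_le[of "fst w" "snd w"] norm_snd_le[of "snd w" "fst w"] by simp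
  qed
  have X: "bounded_linear X" "apply_bcontfun (X w) t = fst w t *\<^sub>R e + snd w t" "norm (X w) \<le> 2 * norm w" for w t
    unfolding X_def by (subst bounded_linear_into_seq[OF _ Xb] |
      rule bounded_linear_into_seq[OF _ Xb] | simp add: linear_iff algebra_simps)+

  \<comment> \<open>\<open>J1\<close>, \<open>J2\<close> are the two components of the response to the remainder, \<open>L1\<close>, \<open>L2\<close> the linear
    parts of the two recursions; the entry \<open>0\<close> of the first recursion is filled by \<open>s v\<close> below.\<close>
  define J1 where "J1 q = Bcontfun (\<lambda>t. case t of 0 \<Rightarrow> 0 | Suc t \<Rightarrow> - (a * (apply_bcontfun q t \<bullet> e)))"
    for q :: "nat \<Rightarrow>\<^sub>C 'v"
  have J1b: "norm (case t of 0 \<Rightarrow> 0 | Suc t \<Rightarrow> - (a * (apply_bcontfun q t \<bullet> e))) \<le> 1 * norm q"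
    for t and q :: "nat \<Rightarrow>\<^sub>C 'v"
  proof -
    have "\<bar>apply_bcontfun q t \<bullet> e\<bar> \<le> norm q" for t
      using Cauchy_Schwarz_ineq2[of "q t" e] norm_bounded[of q t] e by simp
    then have "a * \<bar>apply_bcontfun q t \<bullet> e\<bar> \<le> 1 * norm q" for t
      using a by (intro mult_mono) auto
    then show ?thesis using a by (auto split: nat.split simp: abs_mult)
  qed
  have J1: "bounded_linear J1" "apply_bcontfun (J1 q) t = (case t of 0 \<Rightarrow> 0 | Suc t \<Rightarrow> - (a * (q t \<bullet> e)))"
    "norm (J1 q) \<le> 1 * norm q" for q t
    unfolding J1_def by (subst bounded_linear_into_seq[OF _ J1b] |
      rule bounded_linear_into_seq[OF _ J1b] |
      simp add: linear_iff inner_add_left algebra_simps split: nat.split)+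

  define J2 where "J2 q = Bcontfun (\<lambda>t. apply_bcontfun q t - (apply_bcontfun q t \<bullet> e) *\<^sub>R e)"
    for q :: "nat \<Rightarrow>\<^sub>C 'v"
  have J2b: "norm (apply_bcontfun q t - (apply_bcontfun q t \<bullet> e) *\<^sub>R e) \<le> 1 * norm q"
    for t and q :: "nat \<Rightarrow>\<^sub>C 'v"
    using norm_diff_projection_le[OF e, of "q t"] norm_bounded[of q t] by simp
  have J2: "bounded_linear J2" "apply_bcontfun (J2 q) t = q t - (q t \<bullet> e) *\<^sub>R e"
    "norm (J2 q) \<le> 1 * norm q" for q t
    unfolding J2_def by (subst bounded_linear_into_seq[OF _ J2b] |
      rule bounded_linear_into_seq[OF _ J2b] |
      simp add: linear_iff inner_add_left algebra_simps split: nat.split)+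

  define L1 where "L1 q = Bcontfun (\<lambda>t. case t of 0 \<Rightarrow> 0 | Suc t \<Rightarrow> a * apply_bcontfun q t)"
    for q :: "nat \<Rightarrow>\<^sub>C real"
  have L1b: "norm (case t of 0 \<Rightarrow> 0 | Suc t \<Rightarrow> a * apply_bcontfun q t) \<le> \<kappa> * norm q"
    for t and q :: "nat \<Rightarrow>\<^sub>C real"
  proof -
    have "a * \<bar>apply_bcontfun q t\<bar> \<le> \<kappa> * norm q" for t
      using a norm_bounded[of q t] by (intro mult_mono) (auto simp: \<kappa>_def)
    then show ?thesis using a \<kappa> by (auto split: nat.split simp: abs_mult)
  qed
  have L1: "bounded_linear L1" "apply_bcontfun (L1 q) t = (case t of 0 \<Rightarrow> 0 | Suc t \<Rightarrow> a * q t)"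
    "norm (L1 q) \<le> \<kappa> * norm q" for q t
    unfolding L1_def by (subst bounded_linear_into_seq[OF _ L1b] |
      rule bounded_linear_into_seq[OF _ L1b] |
      simp add: linear_iff inner_add_left algebra_simps split: nat.split)+

  define L2 where "L2 q = Bcontfun (\<lambda>t. \<theta> *\<^sub>R C (apply_bcontfun q (Suc t) - (apply_bcontfun q (Suc t) \<bullet> e) *\<^sub>R e))"
    for q :: "nat \<Rightarrow>\<^sub>C 'v"
  have L2b: "norm (\<theta> *\<^sub>R C (apply_bcontfun q (Suc t) - (apply_bcontfun q (Suc t) \<bullet> e) *\<^sub>R e)) \<le> \<kappa> * norm q"
    for t and q :: "nat \<Rightarrow>\<^sub>C 'v"
  proof -
    let ?z = "q (Suc t) - (q (Suc t) \<bullet> e) *\<^sub>R e"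
    have "norm (C ?z) \<le> \<nu> * norm ?z"
      using e by (intro C\<nu>) (simp add: inner_diff_left norm_eq_1)
    also have "\<dots> \<le> \<nu> * norm q"
      using norm_diff_projection_le[OF e, of "q (Suc t)"] norm_bounded[of q "Suc t"] \<mu>
      by (intro mult_left_mono) auto
    finally have "norm (\<theta> *\<^sub>R C ?z) \<le> (\<theta> * \<nu>) * norm q"
      using \<theta> by simp
    also have "\<dots> \<le> \<kappa> * norm q" by (intro mult_right_mono) (auto simp: \<kappa>_def)
    finally show ?thesis .
  qed
  have L2lin: "linear (\<lambda>q :: nat \<Rightarrow>\<^sub>C 'v. \<theta> *\<^sub>R C (apply_bcontfun q (Suc t) - (apply_bcontfun q (Suc t) \<bullet> e) *\<^sub>R e))" for t
    by (simp add: linear_iff linear_add[OF C] linear_diff[OF C] linear_scale[OF C] inner_add_left algebra_simps)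
  have L2: "bounded_linear L2" "apply_bcontfun (L2 q) t = \<theta> *\<^sub>R C (q (Suc t) - (q (Suc t) \<bullet> e) *\<^sub>R e)"
    "norm (L2 q) \<le> \<kappa> * norm q" for q t
    unfolding L2_def by (simp_all add: bounded_linear_into_seq[OF L2lin L2b] del: norm_scaleR)

  define L where "L w = (L1 (fst w), L2 (snd w))" for w
  have bL: "bounded_linear L"
    unfolding L_def by (intro bounded_linear_Pair bounded_linear_compose[OF L1(1)]
        bounded_linear_compose[OF L2(1)] bounded_linear_fst bounded_linear_snd)
  have Ln: "norm (L w) \<le> \<kappa> * norm w" for w
  proof -
    have "norm (L w) \<le> sqrt ((\<kappa> * norm (fst w))\<^sup>2 + (\<kappa> * norm (snd w))\<^sup>2)"
      using L1(3)[of "fst w"] L2(3)[of "snd w"]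
      by (auto simp: L_def norm_Pair intro!: real_sqrt_le_mono add_mono power_mono)
    also have "\<dots> = \<kappa> * norm w"
      using \<kappa> by (simp add: norm_prod_def power_mult_distrib distrib_left[symmetric] real_sqrt_mult)
    finally show ?thesis .
  qed
  define J where "J q = (J1 q, J2 q)" for q
  have bJ: "bounded_linear J"
    unfolding J_def by (intro bounded_linear_Pair J1 J2)
  have Jn: "norm (J q) \<le> 2 * norm q" for q
    unfolding J_def using J1(3)[of q] J2(3)[of q] by (intro order_trans[OF norm_Pair_le]) auto
  define N where "N w = L w + J (NR (X w))" for w
  define N' where "N' w = Blinfun L + (Blinfun J o\<^sub>L NR' (X w) o\<^sub>L Blinfun X)" for w
  define \<rho> where "\<rho> = r / 4"
  have \<rho>: "0 < \<rho>" using r by (simp add: \<rho>_def)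
  have XB: "X w \<in> cball 0 (r / 2)" if "w \<in> cball 0 \<rho>" for w
    using X(3)[of w] that by (simp add: \<rho>_def)
  have bl[simp]: "blinfun_apply (Blinfun L) = L" "blinfun_apply (Blinfun J) = J" "blinfun_apply (Blinfun X) = X"
    by (auto simp: bounded_linear_Blinfun_apply bL bJ X)
  have N0: "N 0 = 0"
  proof -
    have X0: "X 0 = 0" by (rule linear_0[OF bounded_linear.linear[OF X(1)]])
    have "P t 0 = 0" for t by (simp add: P zero_prod_def)
    then have "NR 0 = 0"
      using WN[of 0] r R0 by (intro bcontfun_eqI) simp
    then show ?thesis
      using linear_0[OF bounded_linear.linear[OF bL]] linear_0[OF bounded_linear.linear[OF bJ]]
      by (simp add: N_def X0)
  qed
  have Nder: "(N has_derivative blinfun_apply (N' w)) (at w within cball 0 \<rho>)" if w: "w \<in> cball 0 \<rho>" for w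
  proof -
    have "((\<lambda>w. NR (X w)) has_derivative (\<lambda>h. NR' (X w) (X h))) (at w within cball 0 \<rho>)"
      by (rule has_derivative_in_compose2[OF WN' _ w])
         (use XB bounded_linear_imp_has_derivative[OF X(1)] in auto)
    then have "(N has_derivative (\<lambda>h. L h + J (NR' (X w) (X h)))) (at w within cball 0 \<rho>)"
      unfolding N_def
      by (intro has_derivative_add bounded_linear_imp_has_derivative[OF bL] bounded_linear.has_derivative[OF bJ])
    moreover have "blinfun_apply (N' w) = (\<lambda>h. L h + J (NR' (X w) (X h)))"
      by (auto simp: N'_def blinfun.add_left)
    ultimately show ?thesis by simp
  qed
  have Ncont: "continuous_on (cball 0 \<rho>) N'"
  proof -
    have "continuous_on (cball 0 \<rho>) (\<lambda>w. NR' (X w))"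
      by (rule continuous_on_compose2[OF Wc linear_continuous_on[OF X(1)]]) (use XB in auto)
    then show ?thesis unfolding N'_def
      by (intro continuous_intros)
  qed
  have Nsmall: "norm (N' w) \<le> (1 + \<kappa>) / 2" if w: "w \<in> cball 0 \<rho>" for w
  proof (rule norm_blinfun_bound)
    fix h
    have "norm (N' w h) \<le> norm (L h) + norm (J (NR' (X w) (X h)))"
      by (simp add: N'_def blinfun.add_left norm_triangle_ineq)
    also have "\<dots> \<le> \<kappa> * norm h + 2 * (2 * \<epsilon> * (2 * norm h))"
    proof (intro add_mono Ln)
      have "norm (NR' (X w) (X h)) \<le> norm (NR' (X w)) * norm (X h)" by (rule norm_blinfun)
      also have "\<dots> \<le> (2 * \<epsilon>) * (2 * norm h)"
        using Wn[OF XB[OF w]] X(3)[of h] \<epsilon> by (intro mult_mono) auto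
      finally show "norm (J (NR' (X w) (X h))) \<le> 2 * (2 * \<epsilon> * (2 * norm h))"
        using Jn[of "NR' (X w) (X h)"] by linarith
    qed
    also have "\<dots> = (\<kappa> + 8 * \<epsilon>) * norm h" by (simp add: algebra_simps)
    also have "\<dots> \<le> ((1 + \<kappa>) / 2) * norm h"
      using \<kappa> by (intro mult_right_mono) (auto simp: \<epsilon>_def field_simps)
    finally show "norm (N' w h) \<le> ((1 + \<kappa>) / 2) * norm h" .
  qed (use \<kappa> in auto)
  \<comment> \<open>The parameter \<open>s\<close> is the initial value of the component along \<open>e\<close>.\<close>
  define v :: "(nat \<Rightarrow>\<^sub>C real) \<times> (nat \<Rightarrow>\<^sub>C 'v)" where "v = (Bcontfun (\<lambda>t. if t = 0 then 1 else 0), 0)"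
  have v: "apply_bcontfun (fst v) t = (if t = 0 then 1 else 0)" "apply_bcontfun (snd v) t = 0" for t
    by (auto simp: v_def apply_Bcontfun_seq[where b = 1])
  have \<kappa>1: "(1 + \<kappa>) / 2 < 1" using \<kappa> by (simp add: field_simps)
  obtain \<delta> w w' where w: "0 < \<delta>" "w 0 = 0"
    "\<And>s. \<bar>s\<bar> < \<delta> \<Longrightarrow> w s \<in> cball 0 \<rho> \<and> w s = s *\<^sub>R v + N (w s)"
    "\<And>s. \<bar>s\<bar> < \<delta> \<Longrightarrow> (w has_vector_derivative w' s) (at s)"
    "continuous_on {-\<delta><..<\<delta>} w'"
    by (rule C1_fixed_point_curve[where N = N and N' = N' and v = v, OF \<rho> \<kappa>1 N0 Nder Ncont Nsmall]) auto
  define ev where "ev w = apply_bcontfun (X w) 0" for w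
  have bev: "bounded_linear ev"
  proof (rule bounded_linear_intro[where K = 2])
    show "norm (ev w) \<le> norm w * 2" for w
      using X(3)[of w] norm_bounded[of "X w" 0] by (simp add: ev_def)
  qed (simp_all add: ev_def linear_add[OF bounded_linear.linear[OF X(1)]]
       linear_scale[OF bounded_linear.linear[OF X(1)]])
  have fp: "fst (w s) 0 = s" "fst (w s) (Suc t) = a * (fst (w s) t - NR (X (w s)) t \<bullet> e)"
    "snd (w s) t = \<theta> *\<^sub>R C (snd (w s) (Suc t) - (snd (w s) (Suc t) \<bullet> e) *\<^sub>R e)
       + (NR (X (w s)) t - (NR (X (w s)) t \<bullet> e) *\<^sub>R e)"
    if "\<bar>s\<bar> < \<delta>" for s t
  proof -
    have f: "fst (w s) t = s * (if t = 0 then 1 else 0) + (L1 (fst (w s)) t + J1 (NR (X (w s))) t)" for t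
      by (subst w(3)[OF that, THEN conjunct2]) (simp add: N_def L_def J_def v)
    have g: "snd (w s) t = L2 (snd (w s)) t + J2 (NR (X (w s))) t" for t
      by (subst w(3)[OF that, THEN conjunct2]) (simp add: N_def L_def J_def v)
    show "fst (w s) 0 = s" using f[of 0] by (simp add: L1 J1)
    show "fst (w s) (Suc t) = a * (fst (w s) t - NR (X (w s)) t \<bullet> e)"
      using f[of "Suc t"] by (simp add: L1 J1 algebra_simps)
    show "snd (w s) t = \<theta> *\<^sub>R C (snd (w s) (Suc t) - (snd (w s) (Suc t) \<bullet> e) *\<^sub>R e)
       + (NR (X (w s)) t - (NR (X (w s)) t \<bullet> e) *\<^sub>R e)"
      using g[of t] by (simp add: L2 J2)
  qed
  have ee: "e \<bullet> e = 1" using e by (simp add: norm_eq_1)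
  have orth: "snd (w s) t \<bullet> e = 0" if "\<bar>s\<bar> < \<delta>" for s t
    by (subst fp(3)[OF that]) (simp add: inner_add_left inner_diff_left Ce' ee)
  show thesis
  proof (rule that[of \<delta> "\<lambda>s. ev (w s)" "\<lambda>s. ev (w' s)"])
    show "0 < \<delta>" by fact
    show "ev (w 0) = 0" using w(2) linear_0[OF bounded_linear.linear[OF bev]] by simp
    show "continuous_on {-\<delta><..<\<delta>} (\<lambda>s. ev (w' s))"
      by (rule bounded_linear.continuous_on[OF bev w(5)])
    fix s assume s: "\<bar>s\<bar> < \<delta>"
    show "ev (w s) \<bullet> e = s"
      by (simp add: ev_def X fp(1)[OF s] inner_add_left orth[OF s] ee)
    show "((\<lambda>s. ev (w s)) has_vector_derivative ev (w' s)) (at s)"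
      by (rule bounded_linear.has_vector_derivative[OF bev w(4)[OF s]])
    have XwB: "X (w s) \<in> cball 0 (r / 2)" using XB w(3)[OF s] by blast
    define x where "x t = \<theta> ^ t *\<^sub>R apply_bcontfun (X (w s)) t" for t
    show "\<exists>x. x 0 = ev (w s) \<and> (\<forall>t. norm (x t) \<le> \<eta>) \<and>
        (\<forall>t. x t = C (x (Suc t)) + R (x t, x (Suc t))) \<and> x \<longlonglongrightarrow> 0"
    proof (intro exI[of _ x] conjI allI)
      show "x 0 = ev (w s)" by (simp add: x_def ev_def)
      fix t
      have "norm (x t) \<le> norm (P t (X (w s)))"
        unfolding x_def P by (rule norm_fst_le)
      also have "\<dots> \<le> r" by (rule Wr[OF XwB])
      finally show "norm (x t) \<le> \<eta>" using r by simp
      define q where "q = NR (X (w s)) t"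
      let ?y = "apply_bcontfun (fst (w s))" and ?z = "apply_bcontfun (snd (w s))"
      have q: "R (x t, x (Suc t)) = \<theta> ^ t *\<^sub>R q"
        using \<theta> by (simp add: q_def WN[OF XwB] x_def P)
      have "(\<theta> * \<mu>) * a = 1" using \<theta> \<mu> by (simp add: a_def)
      then have y: "\<theta> * \<mu> * ?y (Suc t) = ?y t - q \<bullet> e"
        using fp(2)[OF s, of t] by (simp add: q_def mult.assoc[symmetric])
      have z: "?z t = \<theta> *\<^sub>R C (?z (Suc t)) + q - (q \<bullet> e) *\<^sub>R e"
        using fp(3)[OF s, of t] orth[OF s, of "Suc t"] by (simp add: q_def)
      have "\<theta> *\<^sub>R C (?y (Suc t) *\<^sub>R e + ?z (Suc t)) = (\<theta> * \<mu> * ?y (Suc t)) *\<^sub>R e + \<theta> *\<^sub>R C (?z (Suc t))"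
        by (simp add: linear_add[OF C] linear_scale[OF C] Ce algebra_simps)
      also have "\<dots> + q = ?y t *\<^sub>R e + ?z t"
        unfolding y z by (simp add: algebra_simps)
      finally have "\<theta> *\<^sub>R C (X (w s) (Suc t)) + q = X (w s) t"
        by (simp add: X)
      then have "x t = \<theta> ^ t *\<^sub>R (\<theta> *\<^sub>R C (X (w s) (Suc t)) + q)"
        by (simp add: x_def)
      then show "x t = C (x (Suc t)) + R (x t, x (Suc t))"
        unfolding q by (simp add: x_def linear_scale[OF C] scaleR_right_distrib mult.commute)
    next
      show "x \<longlonglongrightarrow> 0"
      proof (rule Lim_null_comparison)
        show "(\<lambda>t. \<theta> ^ t * norm (X (w s))) \<longlonglongrightarrow> 0"
          using \<theta> by (intro tendsto_mult_left_zero LIMSEQ_realpow_zero) auto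
        show "\<forall>\<^sub>F t in sequentially. norm (x t) \<le> \<theta> ^ t * norm (X (w s))"
          using \<theta> by (auto simp: x_def intro!: always_eventually mult_left_mono norm_bounded)
      qed
    qed
  qed
qed

section \<open>Positive matrices\<close>

text \<open>Brouwer's theorem for the normalised action of the matrix on the standard simplex.\<close>

lemma positive_matrix_eigenvector:
  fixes A :: "real^'n^'n"
  assumes pos: "\<And>i j. 0 < A $ i $ j"
  obtains x \<kappa> where "\<And>i. 0 < x $ i" "0 < \<kappa>" "A *v x = \<kappa> *\<^sub>R x"
proof -
  define \<Sigma> where "\<Sigma> x = (\<Sum>i\<in>UNIV. x $ i)" for x :: "real^'n"
  define S where "S = {x :: real^'n. (\<forall>i. 0 \<le> x $ i) \<and> \<Sigma> x = 1}"
  have lin: "linear \<Sigma>" by (simp add: \<Sigma>_def linear_iff sum.distrib sum_distrib_left)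
  have pos_image: "0 < (A *v x) $ i" if "x \<in> S" for x i
  proof -
    obtain j where "0 < x $ j"
    proof (rule ccontr)
      assume "\<not> thesis"
      then have "x $ j = 0" for j using that \<open>x \<in> S\<close> by (metis (mono_tags, lifting) S_def mem_Collect_eq order_le_less)
      then show False using \<open>x \<in> S\<close> by (simp add: S_def \<Sigma>_def)
    qed
    moreover have "0 \<le> x $ j" for j using that by (simp add: S_def)
    ultimately show ?thesis
      unfolding matrix_vector_mult_def using pos
      by (auto intro!: sum_pos2[of _ j] mult_pos_pos mult_nonneg_nonneg simp: less_imp_le)
  qed
  have \<Sigma>pos: "0 < \<Sigma> (A *v x)" if "x \<in> S" for x
    unfolding \<Sigma>_def using pos_image[OF that] by (intro sum_pos) auto
  have \<Sigma>ne: "\<Sigma> (A *v x) \<noteq> 0" if "x \<in> S" for x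
    using \<Sigma>pos[OF that] by simp
  define f where "f x = (1 / \<Sigma> (A *v x)) *\<^sub>R (A *v x)" for x
  have S: "compact S" "convex S" "S \<noteq> {}"
  proof -
    have "norm x \<le> 1" if "x \<in> S" for x
      using norm_le_l1_cart[of x] that by (simp add: S_def \<Sigma>_def)
    then have "bounded S" by (auto simp: bounded_iff)
    moreover have "closed S"
      unfolding S_def \<Sigma>_def
      by (intro closed_Collect_conj closed_Collect_all closed_Collect_le closed_Collect_eq continuous_intros)
    ultimately show "compact S" by (simp add: compact_eq_bounded_closed)
    show "convex S"
      by (auto simp: convex_def S_def linear_add[OF lin] linear_scale[OF lin])
    have "axis undefined 1 \<in> S" by (auto simp: S_def \<Sigma>_def axis_def)
    then show "S \<noteq> {}" by auto
  qed
  have "continuous_on S (\<lambda>x. \<Sigma> (A *v x))" "continuous_on S (\<lambda>x. A *v x)"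
    by (intro linear_continuous_on_compose[OF _ lin] linear_continuous_on matrix_vector_mul_bounded_linear)+
  then have contf: "continuous_on S f"
    unfolding f_def using \<Sigma>ne by (intro continuous_intros) auto
  have "f x \<in> S" if "x \<in> S" for x
    using pos_image[OF that] \<Sigma>pos[OF that] by (simp add: f_def S_def linear_scale[OF lin] less_imp_le)
  then have "f \<in> S \<rightarrow> S" by blast
  then obtain x where x: "x \<in> S" "f x = x" using brouwer[OF S contf] by blast
  have eig: "A *v x = \<Sigma> (A *v x) *\<^sub>R x"
  proof -
    have "\<Sigma> (A *v x) *\<^sub>R f x = A *v x" using \<Sigma>ne[OF x(1)] by (simp add: f_def)
    then show ?thesis by (simp add: x(2))
  qed
  show thesis
  proof
    show "0 < \<Sigma> (A *v x)" by (rule \<Sigma>pos[OF x(1)])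
    then show "0 < x $ i" for i
      using pos_image[OF x(1), of i] by (subst (asm) eig) (simp add: zero_less_mult_iff)
    show "A *v x = \<Sigma> (A *v x) *\<^sub>R x" by (rule eig)
  qed
qed

text \<open>The left and the right positive eigenvector share their eigenvalue: evaluate the bilinear form
  \<open>m \<bullet> (A *v e)\<close> in both ways and divide by \<open>m \<bullet> e > 0\<close>.\<close>

lemma perron_pair:
  fixes A :: "real^'n^'n"
  assumes pos: "\<And>i j. 0 < A $ i $ j"
  obtains e l \<mu> where "\<And>i. 0 < e $ i" "\<And>i. 0 < l $ i" "l \<bullet> e = 1" "0 < \<mu>"
    "A *v e = \<mu> *\<^sub>R e" "\<And>x. l \<bullet> (A *v x) = \<mu> * (l \<bullet> x)"
proof -
  obtain e \<mu> where e: "\<And>i. 0 < e $ i" "0 < \<mu>" "A *v e = \<mu> *\<^sub>R e"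
    using positive_matrix_eigenvector[OF pos] by blast
  obtain m \<nu> where m: "\<And>i. 0 < m $ i" "transpose A *v m = \<nu> *\<^sub>R m"
  proof (rule positive_matrix_eigenvector[of "transpose A"])
    show "0 < transpose A $ i $ j" for i j by (simp add: transpose_def pos)
  qed blast
  have mA: "m \<bullet> (A *v x) = \<nu> * (m \<bullet> x)" for x
    by (metis dot_lmul_matrix inner_scaleR_left m(2) transpose_matrix_vector)
  have me: "0 < m \<bullet> e"
    unfolding inner_vec_def using e(1) m(1) by (auto intro!: sum_pos)
  have "\<mu> = \<nu>" using mA[of e] me by (simp add: e(3))
  show thesis
  proof (rule that[of e "(1 / (m \<bullet> e)) *\<^sub>R m" \<mu>])
    show "((1 / (m \<bullet> e)) *\<^sub>R m) \<bullet> (A *v x) = \<mu> * (((1 / (m \<bullet> e)) *\<^sub>R m) \<bullet> x)" for x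
      by (simp add: mA \<open>\<mu> = \<nu>\<close>)
  qed (use e m me in auto)
qed

text \<open>The weights \<open>l\<^sub>i / e\<^sub>i\<close> turn a nonnegative matrix into one of Euclidean operator norm at most its
  Perron eigenvalue. In row \<open>i\<close>, Cauchy-Schwarz with the entries split by \<open>e\<close> produces the factor
  \<open>(A e)\<^sub>i = \<kappa> e\<^sub>i\<close>; summing the rows against \<open>l\<close> produces the second factor \<open>\<kappa>\<close>.\<close>

lemma schur_test:
  fixes A :: "real^'n^'n"
  assumes A: "\<And>i j. 0 \<le> A $ i $ j" and e: "\<And>i. 0 < e $ i" and l: "\<And>i. 0 < l $ i"
    and Ae: "A *v e = \<kappa> *\<^sub>R e" and lA: "\<And>x. l \<bullet> (A *v x) = \<kappa> * (l \<bullet> x)"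
  shows "(\<Sum>i\<in>UNIV. l $ i / e $ i * ((A *v x) $ i)\<^sup>2) \<le> \<kappa>\<^sup>2 * (\<Sum>i\<in>UNIV. l $ i / e $ i * (x $ i)\<^sup>2)"
proof -
  define y :: "real^'n" where "y = (\<chi> j. (x $ j)\<^sup>2 / e $ j)"
  have "0 \<le> (A *v e) $ i" for i
    using A e by (auto simp: matrix_vector_mult_def less_imp_le intro!: sum_nonneg mult_nonneg_nonneg)
  from this[of undefined] have \<kappa>: "0 \<le> \<kappa>" using e[of undefined] by (simp add: Ae zero_le_mult_iff)
  have row: "((A *v x) $ i)\<^sup>2 \<le> \<kappa> * e $ i * (A *v y) $ i" for i
  proof -
    have "((A *v x) $ i)\<^sup>2 = (\<Sum>j\<in>UNIV. sqrt (A $ i $ j * e $ j) * (sqrt (A $ i $ j / e $ j) * x $ j))\<^sup>2"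
    proof -
      have eq: "A $ i $ j * x $ j = sqrt (A $ i $ j * e $ j) * (sqrt (A $ i $ j / e $ j) * x $ j)" for j
      proof -
        have "sqrt (A $ i $ j * e $ j) * sqrt (A $ i $ j / e $ j) = sqrt ((A $ i $ j)\<^sup>2)"
          using e[of j] by (simp add: real_sqrt_mult[symmetric] power2_eq_square)
        then show ?thesis using A[of i j] by (simp add: mult.assoc[symmetric])
      qed
      show ?thesis by (simp only: matrix_vector_mult_def vec_lambda_beta eq)
    qed
    also have "\<dots> \<le> (\<Sum>j\<in>UNIV. (sqrt (A $ i $ j * e $ j))\<^sup>2) * (\<Sum>j\<in>UNIV. (sqrt (A $ i $ j / e $ j) * x $ j)\<^sup>2)"
      by (rule Cauchy_Schwarz_ineq_sum)
    also have "(\<Sum>j\<in>UNIV. (sqrt (A $ i $ j * e $ j))\<^sup>2) = (A *v e) $ i"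
      using A e by (simp add: matrix_vector_mult_def less_imp_le)
    also have "(\<Sum>j\<in>UNIV. (sqrt (A $ i $ j / e $ j) * x $ j)\<^sup>2) = (A *v y) $ i"
      using A e by (simp add: matrix_vector_mult_def y_def power_mult_distrib less_imp_le)
    finally show ?thesis by (simp add: Ae)
  qed
  have "(\<Sum>i\<in>UNIV. l $ i / e $ i * ((A *v x) $ i)\<^sup>2) \<le> (\<Sum>i\<in>UNIV. \<kappa> * (l $ i * (A *v y) $ i))"
  proof (rule sum_mono)
    fix i
    have "l $ i / e $ i * ((A *v x) $ i)\<^sup>2 \<le> l $ i / e $ i * (\<kappa> * e $ i * (A *v y) $ i)"
      using row l[of i] e[of i] by (intro mult_left_mono) auto
    also have "\<dots> = \<kappa> * (l $ i * (A *v y) $ i)" using e[of i] by simp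
    finally show "l $ i / e $ i * ((A *v x) $ i)\<^sup>2 \<le> \<kappa> * (l $ i * (A *v y) $ i)" .
  qed
  also have "\<dots> = \<kappa> * (l \<bullet> (A *v y))" by (simp add: inner_vec_def sum_distrib_left)
  also have "\<dots> = \<kappa>\<^sup>2 * (\<Sum>i\<in>UNIV. l $ i / e $ i * (x $ i)\<^sup>2)"
    unfolding lA by (simp add: inner_vec_def y_def power2_eq_square)
  finally show ?thesis .
qed

text \<open>On the kernel of \<open>l\<close> the matrix \<open>A\<close> acts like \<open>A - \<gamma> e l\<^sup>T\<close>. For small \<open>\<gamma>\<close> this matrix still
  is nonnegative and has the same eigenvectors, but its Perron eigenvalue is only \<open>\<mu> - \<gamma>\<close>.\<close>

lemma perron_gap:
  fixes A :: "real^'n^'n"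
  assumes pos: "\<And>i j. 0 < A $ i $ j" and e: "\<And>i. 0 < e $ i" and l: "\<And>i. 0 < l $ i" and le: "l \<bullet> e = 1"
    and Ae: "A *v e = \<mu> *\<^sub>R e" and lA: "\<And>x. l \<bullet> (A *v x) = \<mu> * (l \<bullet> x)"
  obtains \<nu> where "0 \<le> \<nu>" "\<nu> < \<mu>"
    "\<And>z. l \<bullet> z = 0 \<Longrightarrow> (\<Sum>i\<in>UNIV. l $ i / e $ i * ((A *v z) $ i)\<^sup>2) \<le> \<nu>\<^sup>2 * (\<Sum>i\<in>UNIV. l $ i / e $ i * (z $ i)\<^sup>2)"
proof -
  define \<gamma> where "\<gamma> = Min (range (\<lambda>(i, j). A $ i $ j / (e $ i * l $ j)))"
  have \<gamma>: "0 < \<gamma>" unfolding \<gamma>_def using pos e l by (subst Min_gr_iff) auto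
  have \<gamma>_le: "\<gamma> * (e $ i * l $ j) \<le> A $ i $ j" for i j
  proof -
    have "\<gamma> \<le> A $ i $ j / (e $ i * l $ j)" unfolding \<gamma>_def by (rule Min_le) auto
    then show ?thesis using e[of i] l[of j] by (simp add: pos_le_divide_eq)
  qed
  define K :: "real^'n^'n" where "K = (\<chi> i j. A $ i $ j - \<gamma> * (e $ i * l $ j))"
  have Kx: "K *v x = A *v x - (\<gamma> * (l \<bullet> x)) *\<^sub>R e" for x
    by (simp add: vec_eq_iff K_def matrix_vector_mult_def inner_vec_def left_diff_distrib sum_subtractf
        sum_distrib_left sum_distrib_right algebra_simps)
  have K0: "0 \<le> K $ i $ j" for i j using \<gamma>_le by (simp add: K_def)
  have Ke: "K *v e = (\<mu> - \<gamma>) *\<^sub>R e" by (simp add: Kx Ae le algebra_simps)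
  have lK: "l \<bullet> (K *v x) = (\<mu> - \<gamma>) * (l \<bullet> x)" for x
    by (simp add: Kx inner_diff_right lA le algebra_simps)
  show thesis
  proof
    have "0 \<le> (K *v e) $ undefined"
      using K0 e by (auto simp: matrix_vector_mult_def less_imp_le intro!: sum_nonneg mult_nonneg_nonneg)
    then show "0 \<le> \<mu> - \<gamma>" using e[of undefined] by (simp add: Ke zero_le_mult_iff)
    show "\<mu> - \<gamma> < \<mu>" using \<gamma> by simp
    show "(\<Sum>i\<in>UNIV. l $ i / e $ i * ((A *v z) $ i)\<^sup>2) \<le> (\<mu> - \<gamma>)\<^sup>2 * (\<Sum>i\<in>UNIV. l $ i / e $ i * (z $ i)\<^sup>2)"
      if "l \<bullet> z = 0" for z
      using schur_test[OF K0 e l Ke lK, of z] that by (simp add: Kx)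
  qed
qed


text \<open>After scaling coordinate \<open>i\<close> by \<open>d\<^sub>i\<close>, where \<open>d\<^sub>i\<^sup>2 = l\<^sub>i / e\<^sub>i\<close>, the weighted norm of the Schur
  test becomes the Euclidean norm, and left and right Perron eigenvector become the same unit vector,
  so its orthogonal complement is invariant. A diagonal entry that is at least \<open>1\<close> makes the Perron
  eigenvalue exceed \<open>1\<close>, because the other entries of that row are positive.\<close>

theorem stable_curve_positive_matrix:
  fixes A :: "real^'n^'n" and R :: "(real^'n) \<times> (real^'n) \<Rightarrow> real^'n"
    and R' :: "(real^'n) \<times> (real^'n) \<Rightarrow> ((real^'n) \<times> (real^'n)) \<Rightarrow>\<^sub>L (real^'n)"
  assumes pos: "\<And>i j. 0 < A $ i $ j" and diag: "1 \<le> A $ i0 $ i0" "i0 \<noteq> i1"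
    and S: "open S" "0 \<in> S"
    and der: "\<And>p. p \<in> S \<Longrightarrow> (R has_derivative blinfun_apply (R' p)) (at p)"
    and cont: "continuous_on S R'" and R0: "R 0 = 0" and R'0: "R' 0 = 0" and \<eta>: "0 < \<eta>"
  obtains l \<delta> \<sigma> \<sigma>' where "\<And>i. 0 < l $ i" "0 < \<delta>" "\<sigma> 0 = 0" "continuous_on {-\<delta><..<\<delta>} \<sigma>'"
    "\<And>s. \<bar>s\<bar> < \<delta> \<Longrightarrow> l \<bullet> \<sigma> s = s"
    "\<And>s. \<bar>s\<bar> < \<delta> \<Longrightarrow> (\<sigma> has_vector_derivative \<sigma>' s) (at s)"
    "\<And>s. \<bar>s\<bar> < \<delta> \<Longrightarrow> \<exists>x :: nat \<Rightarrow> real^'n. x 0 = \<sigma> s \<and> (\<forall>t. norm (x t) \<le> \<eta>) \<and>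
        (\<forall>t. x t = A *v x (Suc t) + R (x t, x (Suc t))) \<and> x \<longlonglongrightarrow> 0"
proof -
  obtain e l \<mu> where e: "\<And>i. 0 < e $ i" and l: "\<And>i. 0 < l $ i" and le: "l \<bullet> e = 1" and \<mu>0: "0 < \<mu>"
    and Ae: "A *v e = \<mu> *\<^sub>R e" and lA: "\<And>x. l \<bullet> (A *v x) = \<mu> * (l \<bullet> x)"
    using perron_pair[OF pos] by blast
  obtain \<nu> where \<nu>: "0 \<le> \<nu>" "\<nu> < \<mu>"
    "\<And>z. l \<bullet> z = 0 \<Longrightarrow> (\<Sum>i\<in>UNIV. l $ i / e $ i * ((A *v z) $ i)\<^sup>2) \<le> \<nu>\<^sup>2 * (\<Sum>i\<in>UNIV. l $ i / e $ i * (z $ i)\<^sup>2)"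
    using perron_gap[OF pos e l le Ae lA] by blast
  have \<mu>: "1 < \<mu>"
  proof -
    have "1 * e $ i0 + 0 < A $ i0 $ i0 * e $ i0 + A $ i0 $ i1 * e $ i1"
      using diag pos e by (intro add_le_less_mono mult_right_mono mult_pos_pos) (auto intro: less_imp_le)
    also have "\<dots> = (\<Sum>j\<in>{i0, i1}. A $ i0 $ j * e $ j)" using diag by simp
    also have "\<dots> \<le> (A *v e) $ i0"
      unfolding matrix_vector_mult_def vec_lambda_beta
      using pos e by (intro sum_mono2) (auto intro!: mult_nonneg_nonneg simp: less_imp_le)
    also have "\<dots> = \<mu> * e $ i0" by (simp add: Ae)
    finally show ?thesis using e[of i0] by simp
  qed
  define d where "d i = sqrt (l $ i / e $ i)" for i
  have d: "0 < d i" "(d i)\<^sup>2 = l $ i / e $ i" for i using e l by (auto simp: d_def less_imp_le)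
  define D where "D x = (\<chi> i. d i * x $ i)" for x :: "real^'n"
  define E where "E x = (\<chi> i. x $ i / d i)" for x :: "real^'n"
  have DE: "D (E x) = x" "E (D x) = x" for x
  proof -
    have "d i \<noteq> 0" for i using d(1)[of i] by simp
    then show "D (E x) = x" "E (D x) = x" by (simp_all add: D_def E_def vec_eq_iff)
  qed
  have linD: "linear D" and linE: "linear E"
    by (simp_all add: D_def E_def linear_iff vec_eq_iff distrib_left add_divide_distrib)
  have bD: "bounded_linear D" and bE: "bounded_linear E"
    using linD linE by (auto simp: linear_conv_bounded_linear)
  have Dl: "D x \<bullet> D e = l \<bullet> x" for x
  proof -
    have eq: "d i * x $ i * (d i * e $ i) = l $ i * x $ i" for i
    proof -
      have "d i * x $ i * (d i * e $ i) = (d i)\<^sup>2 * e $ i * x $ i" by (simp add: power2_eq_square)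
      then show ?thesis using e[of i] by (simp add: d(2))
    qed
    show ?thesis by (simp only: D_def inner_vec_def vec_lambda_beta inner_real_def eq)
  qed
  have Dnorm: "(norm (D x))\<^sup>2 = (\<Sum>i\<in>UNIV. l $ i / e $ i * (x $ i)\<^sup>2)" for x
  proof -
    have "(norm (D x))\<^sup>2 = (\<Sum>i\<in>UNIV. (d i)\<^sup>2 * (x $ i)\<^sup>2)"
      unfolding power2_norm_eq_inner by (simp add: D_def inner_vec_def power2_eq_square algebra_simps)
    then show ?thesis by (simp only: d(2))
  qed
  define C where "C x = D (A *v E x)" for x
  have linC: "linear C"
    by (simp add: linear_iff C_def linear_add[OF linD] linear_add[OF linE] linear_scale[OF linD]
        linear_scale[OF linE] linear_add[OF matrix_vector_mul_linear] linear_scale[OF matrix_vector_mul_linear])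
  define E2 where "E2 p = (E (fst p), E (snd p))" for p
  have bE2: "bounded_linear E2"
    unfolding E2_def by (intro bounded_linear_Pair bounded_linear_compose[OF bE] bounded_linear_fst bounded_linear_snd)
  define Q where "Q p = D (R (E2 p))" for p
  define Q' where "Q' p = (Blinfun D o\<^sub>L R' (E2 p) o\<^sub>L Blinfun E2)" for p
  have [simp]: "blinfun_apply (Blinfun D) = D" "blinfun_apply (Blinfun E2) = E2"
    by (auto simp: bounded_linear_Blinfun_apply bD bE2)
  have Q1: "D e \<bullet> D e = 1" using Dl[of e] le by simp
  have E20: "E2 0 = 0" by (rule linear_0[OF bounded_linear.linear[OF bE2]])
  obtain K where K: "0 < K" "\<And>x. norm (E x) \<le> norm x * K"
    using bounded_linear.pos_bounded[OF bE] by blast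
  have \<eta>K: "0 < \<eta> / K" using \<eta> K by simp
  obtain \<delta> \<sigma> \<sigma>' where st5: "\<And>s. \<bar>s\<bar> < \<delta> \<Longrightarrow> (\<sigma> has_vector_derivative \<sigma>' s) (at s)"
    and st: "0 < \<delta>" "\<sigma> 0 = 0" "continuous_on {-\<delta><..<\<delta>} \<sigma>'"
    "\<And>s. \<bar>s\<bar> < \<delta> \<Longrightarrow> \<sigma> s \<bullet> D e = s"
    "\<And>s. \<bar>s\<bar> < \<delta> \<Longrightarrow> \<exists>x :: nat \<Rightarrow> real^'n. x 0 = \<sigma> s \<and> (\<forall>t. norm (x t) \<le> \<eta> / K) \<and>
        (\<forall>t. x t = C (x (Suc t)) + Q (x t, x (Suc t))) \<and> x \<longlonglongrightarrow> 0"
  proof (rule stable_curve_orthogonal[where C = C and e = "D e" and \<mu> = \<mu> and \<nu> = \<nu> and S = "E2 -` S"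
        and R = Q and R' = Q' and \<eta> = "\<eta> / K"])
    show "linear C" by (rule linC)
    show "norm (D e) = 1" using Q1 by (simp add: norm_eq_1)
    show "C (D e) = \<mu> *\<^sub>R D e" by (simp add: C_def DE Ae linear_scale[OF linD])
    show "C x \<bullet> D e = \<mu> * (x \<bullet> D e)" for x
      using Dl[of "A *v E x"] Dl[of "E x"] by (simp add: C_def DE lA)
    show "norm (C z) \<le> \<nu> * norm z" if "z \<bullet> D e = 0" for z
    proof (rule power2_le_imp_le)
      have "l \<bullet> E z = 0" using that Dl[of "E z"] by (simp add: DE)
      from \<nu>(3)[OF this] show "(norm (C z))\<^sup>2 \<le> (\<nu> * norm z)\<^sup>2"
        unfolding Dnorm[symmetric] by (simp add: C_def DE power_mult_distrib)
    qed (use \<nu> in simp)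
    show "1 < \<mu>" "0 \<le> \<nu>" "\<nu> < \<mu>" by fact+
    show "open (E2 -` S)"
      by (rule open_vimage[OF S(1)]) (rule linear_continuous_on[OF bE2])
    show "0 \<in> E2 -` S" using S(2) by (simp add: E20)
    show "(Q has_derivative blinfun_apply (Q' p)) (at p)" if "p \<in> E2 -` S" for p
    proof -
      have "((\<lambda>p. R (E2 p)) has_derivative (\<lambda>h. R' (E2 p) (E2 h))) (at p)"
        using that by (intro has_derivative_compose[OF bounded_linear_imp_has_derivative[OF bE2] der]) auto
      then have "(Q has_derivative (\<lambda>h. D (R' (E2 p) (E2 h)))) (at p)"
        unfolding Q_def by (rule bounded_linear.has_derivative[OF bD])
      moreover have "blinfun_apply (Q' p) = (\<lambda>h. D (R' (E2 p) (E2 h)))" by (auto simp: Q'_def)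
      ultimately show ?thesis by simp
    qed
    show "continuous_on (E2 -` S) Q'"
    proof -
      have "continuous_on (E2 -` S) (\<lambda>p. R' (E2 p))"
        by (rule continuous_on_compose2[OF cont linear_continuous_on[OF bE2]]) auto
      then show ?thesis unfolding Q'_def by (intro continuous_intros)
    qed
    show "Q 0 = 0" by (simp add: Q_def E20 R0 linear_0[OF linD])
    show "Q' 0 = 0" by (simp add: Q'_def E20 R'0)
    show "0 < \<eta> / K" by (rule \<eta>K)
  qed (rule that)
  show thesis
  proof (rule that[of l \<delta> "\<lambda>s. E (\<sigma> s)" "\<lambda>s. E (\<sigma>' s)"])
    show "0 < l $ i" for i by (rule l)
    show "0 < \<delta>" by fact
    show "E (\<sigma> 0) = 0" by (simp add: st(2) linear_0[OF linE])
    show "continuous_on {-\<delta><..<\<delta>} (\<lambda>s. E (\<sigma>' s))"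
      by (rule bounded_linear.continuous_on[OF bE st(3)])
    fix s assume s: "\<bar>s\<bar> < \<delta>"
    show "l \<bullet> E (\<sigma> s) = s" using st(4)[OF s] Dl[of "E (\<sigma> s)"] by (simp add: DE)
    show "((\<lambda>s. E (\<sigma> s)) has_vector_derivative E (\<sigma>' s)) (at s)"
      by (rule bounded_linear.has_vector_derivative[OF bE st5[OF s]])
    from st(5)[OF s] obtain x where x: "x \<longlonglongrightarrow> 0" "x 0 = \<sigma> s" "\<forall>t. norm (x t) \<le> \<eta> / K"
      "\<forall>t. x t = C (x (Suc t)) + Q (x t, x (Suc t))"
      by (elim exE conjE) (rule that)
    show "\<exists>x. x 0 = E (\<sigma> s) \<and> (\<forall>t. norm (x t) \<le> \<eta>) \<and>
        (\<forall>t. x t = A *v x (Suc t) + R (x t, x (Suc t))) \<and> x \<longlonglongrightarrow> 0"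
    proof (intro exI[of _ "\<lambda>t. E (x t)"] conjI allI)
      show "E (x 0) = E (\<sigma> s)" by (simp add: x(2))
      show "norm (E (x t)) \<le> \<eta>" for t
        using K(2)[of "x t"] x(3)[THEN spec, of t] K(1) by (simp add: pos_le_divide_eq)
      show "E (x t) = A *v E (x (Suc t)) + R (E (x t), E (x (Suc t)))" for t
        by (rule trans[OF arg_cong[where f = E, OF x(4)[THEN spec, of t]]]) (simp add: linear_add[OF linE] C_def Q_def DE E2_def)
      show "(\<lambda>t. E (x t)) \<longlonglongrightarrow> 0"
        using bounded_linear.tendsto[OF bE x(1)] by (simp add: linear_0[OF linE])
    qed
  qed
qed

section \<open>Continuously differentiable maps\<close>

text \<open>Continuous differentiability near \<open>x\<close>, together with the derivative at \<open>x\<close>. Leaving the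
  neighbourhood existentially quantified frees the closure rules from all bookkeeping of domains, and
  carrying \<open>D\<close> along makes them compute the linearization.\<close>

definition C1_at :: "('a::real_normed_vector \<Rightarrow> 'b::real_normed_vector) \<Rightarrow> 'a \<Rightarrow> ('a \<Rightarrow> 'b) \<Rightarrow> bool" where
  "C1_at f x D \<longleftrightarrow> (\<exists>S f'. open S \<and> x \<in> S \<and> (\<forall>y\<in>S. (f has_derivative blinfun_apply (f' y)) (at y)) \<and>
     continuous_on S f' \<and> blinfun_apply (f' x) = D)"

lemma C1_atI:
  assumes "open S" "x \<in> S" "\<And>y. y \<in> S \<Longrightarrow> (f has_derivative blinfun_apply (f' y)) (at y)"
    "continuous_on S f'" "blinfun_apply (f' x) = D"
  shows "C1_at f x D"
  using assms unfolding C1_at_def by blast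

lemma C1_atE:
  assumes "C1_at f x D"
  obtains S f' where "open S" "x \<in> S" "\<And>y. y \<in> S \<Longrightarrow> (f has_derivative blinfun_apply (f' y)) (at y)"
    "continuous_on S f'" "blinfun_apply (f' x) = D"
  using assms unfolding C1_at_def by blast

lemma C1_at_const: "C1_at (\<lambda>_. c) x (\<lambda>_. 0)"
  by (rule C1_atI[of UNIV _ _ "\<lambda>_. 0"]) (auto simp: zero_blinfun.rep_eq)

lemma C1_at_bounded_linear:
  assumes "bounded_linear f"
  shows "C1_at f x f"
  by (rule C1_atI[of UNIV _ _ "\<lambda>_. Blinfun f"])
    (auto simp: bounded_linear_Blinfun_apply[OF assms] bounded_linear_imp_has_derivative[OF assms])

lemma C1_at_add:
  assumes "C1_at f x D" "C1_at g x E"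
  shows "C1_at (\<lambda>y. f y + g y) x (\<lambda>h. D h + E h)"
proof -
  obtain S f' where f: "open S" "x \<in> S" "\<And>y. y \<in> S \<Longrightarrow> (f has_derivative blinfun_apply (f' y)) (at y)"
    "continuous_on S f'" "blinfun_apply (f' x) = D" using assms(1) by (blast elim: C1_atE)
  obtain T g' where g: "open T" "x \<in> T" "\<And>y. y \<in> T \<Longrightarrow> (g has_derivative blinfun_apply (g' y)) (at y)"
    "continuous_on T g'" "blinfun_apply (g' x) = E" using assms(2) by (blast elim: C1_atE)
  show ?thesis
  proof (rule C1_atI)
    show "open (S \<inter> T)" "x \<in> S \<inter> T" using f g by auto
    show "((\<lambda>y. f y + g y) has_derivative blinfun_apply (f' y + g' y)) (at y)" if "y \<in> S \<inter> T" for y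
    proof -
      have "blinfun_apply (f' y + g' y) = (\<lambda>h. f' y h + g' y h)" by (auto simp: blinfun.add_left)
      then show ?thesis using has_derivative_add[OF f(3) g(3)] that by simp
    qed
    show "continuous_on (S \<inter> T) (\<lambda>y. f' y + g' y)"
      by (intro continuous_on_add continuous_on_subset[OF f(4)] continuous_on_subset[OF g(4)]) auto
    show "blinfun_apply (f' x + g' x) = (\<lambda>h. D h + E h)" using f(5) g(5) by (auto simp: blinfun.add_left)
  qed
qed

lemma C1_at_compose:
  assumes "C1_at f x D" "C1_at g (f x) E"
  shows "C1_at (\<lambda>y. g (f y)) x (\<lambda>h. E (D h))"
proof -
  obtain S f' where f: "open S" "x \<in> S" "\<And>y. y \<in> S \<Longrightarrow> (f has_derivative blinfun_apply (f' y)) (at y)"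
    "continuous_on S f'" "blinfun_apply (f' x) = D" using assms(1) by (blast elim: C1_atE)
  obtain T g' where g: "open T" "f x \<in> T" "\<And>y. y \<in> T \<Longrightarrow> (g has_derivative blinfun_apply (g' y)) (at y)"
    "continuous_on T g'" "blinfun_apply (g' (f x)) = E" using assms(2) by (blast elim: C1_atE)
  have contf: "continuous_on S f"
    using f(3) by (intro continuous_at_imp_continuous_on ballI) (blast intro: has_derivative_continuous)
  show ?thesis
  proof (rule C1_atI)
    show "open (S \<inter> f -` T)" using continuous_open_preimage[OF contf f(1) g(1)] .
    show "x \<in> S \<inter> f -` T" using f g by auto
    show "((\<lambda>y. g (f y)) has_derivative blinfun_apply (g' (f y) o\<^sub>L f' y)) (at y)"
      if "y \<in> S \<inter> f -` T" for y
    proof -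
      have "blinfun_apply (g' (f y) o\<^sub>L f' y) = (\<lambda>h. g' (f y) (f' y h))" by auto
      then show ?thesis using has_derivative_compose[OF f(3) g(3), of y] that by simp
    qed
    have "continuous_on (S \<inter> f -` T) (\<lambda>y. g' (f y))"
      by (rule continuous_on_compose2[OF g(4) continuous_on_subset[OF contf]]) auto
    then show "continuous_on (S \<inter> f -` T) (\<lambda>y. g' (f y) o\<^sub>L f' y)"
      by (intro continuous_intros continuous_on_subset[OF f(4)]) auto
    show "blinfun_apply (g' (f x) o\<^sub>L f' x) = (\<lambda>h. E (D h))" using f(5) g(5) by auto
  qed
qed

lemma C1_at_mult:
  fixes f g :: "'a::real_normed_vector \<Rightarrow> real"
  assumes "C1_at f x D" "C1_at g x E"
  shows "C1_at (\<lambda>y. f y * g y) x (\<lambda>h. f x * E h + g x * D h)"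
proof -
  obtain S f' where f: "open S" "x \<in> S" "\<And>y. y \<in> S \<Longrightarrow> (f has_derivative blinfun_apply (f' y)) (at y)"
    "continuous_on S f'" "blinfun_apply (f' x) = D" using assms(1) by (blast elim: C1_atE)
  obtain T g' where g: "open T" "x \<in> T" "\<And>y. y \<in> T \<Longrightarrow> (g has_derivative blinfun_apply (g' y)) (at y)"
    "continuous_on T g'" "blinfun_apply (g' x) = E" using assms(2) by (blast elim: C1_atE)
  have contf: "continuous_on S f" "continuous_on T g"
    using f(3) g(3) by (auto intro!: continuous_at_imp_continuous_on dest: has_derivative_continuous)
  show ?thesis
  proof (rule C1_atI)
    show "open (S \<inter> T)" "x \<in> S \<inter> T" using f g by auto
    show "((\<lambda>y. f y * g y) has_derivative blinfun_apply (f y *\<^sub>R g' y + g y *\<^sub>R f' y)) (at y)" if "y \<in> S \<inter> T" for y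
    proof -
      have "blinfun_apply (f y *\<^sub>R g' y + g y *\<^sub>R f' y) = (\<lambda>h. f y * g' y h + f' y h * g y)"
        by (auto simp: blinfun.bilinear_simps)
      then show ?thesis using has_derivative_mult[OF f(3)[of y] g(3)[of y]] that by simp
    qed
    show "continuous_on (S \<inter> T) (\<lambda>y. f y *\<^sub>R g' y + g y *\<^sub>R f' y)"
      by (intro continuous_intros continuous_on_subset[OF f(4)] continuous_on_subset[OF g(4)]
          continuous_on_subset[OF contf(1)] continuous_on_subset[OF contf(2)]) auto
    show "blinfun_apply (f x *\<^sub>R g' x + g x *\<^sub>R f' x) = (\<lambda>h. f x * E h + g x * D h)"
      using f(5) g(5) by (auto simp: blinfun.bilinear_simps)
  qed
qed

lemma C1_at_DERIV:
  fixes g :: "real \<Rightarrow> real"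
  assumes "open T" "t \<in> T" "\<And>y. y \<in> T \<Longrightarrow> (g has_real_derivative g' y) (at y)" "continuous_on T g'"
  shows "C1_at g t (\<lambda>h. g' t * h)"
proof (rule C1_atI[OF assms(1,2)])
  show "(g has_derivative blinfun_apply (blinfun_scaleR_left (g' y))) (at y)" if "y \<in> T" for y
  proof -
    have "blinfun_apply (blinfun_scaleR_left (g' y)) = (*) (g' y)" by (auto simp: mult.commute)
    then show ?thesis using assms(3)[OF that] by (simp add: has_field_derivative_def)
  qed
  show "continuous_on T (\<lambda>y. blinfun_scaleR_left (g' y))"
    using bounded_linear.continuous_on[OF bounded_linear_blinfun_scaleR_left assms(4)] .
  show "blinfun_apply (blinfun_scaleR_left (g' t)) = (\<lambda>h. g' t * h)" by (auto simp: mult.commute)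
qed

lemma C1_at_sum:
  assumes "finite I" "\<And>i. i \<in> I \<Longrightarrow> C1_at (f i) x (D i)"
  shows "C1_at (\<lambda>y. \<Sum>i\<in>I. f i y) x (\<lambda>h. \<Sum>i\<in>I. D i h)"
  using assms
proof (induction I rule: finite_induct)
  case empty
  then show ?case by (simp add: C1_at_const)
next
  case (insert i I)
  then show ?case using C1_at_add[of "f i" x "D i" "\<lambda>y. \<Sum>i\<in>I. f i y" "\<lambda>h. \<Sum>i\<in>I. D i h"] by simp
qed

lemma C1_at_vec:
  fixes f :: "'a::real_normed_vector \<Rightarrow> real^'n"
  assumes "\<And>i. C1_at (\<lambda>y. f y $ i) x (\<lambda>h. D h $ i)"
  shows "C1_at f x D"
proof -
  have bl: "bounded_linear (\<lambda>r. r *\<^sub>R (axis i 1 :: real^'n))" for i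
    by (rule bounded_linear_scaleR_left)
  have "C1_at (\<lambda>y. \<Sum>i\<in>UNIV. (f y $ i) *\<^sub>R (axis i 1 :: real^'n)) x (\<lambda>h. \<Sum>i\<in>UNIV. (D h $ i) *\<^sub>R axis i 1)"
    by (intro C1_at_sum C1_at_compose[OF assms C1_at_bounded_linear[OF bl]]) simp
  moreover have "(\<Sum>i\<in>UNIV. (v $ i) *\<^sub>R (axis i 1 :: real^'n)) = v" for v
    using basis_expansion[of v] by (simp add: scalar_mult_eq_scaleR)
  ultimately show ?thesis by simp
qed

lemma C1_at_cmult:
  fixes f :: "'a::real_normed_vector \<Rightarrow> real"
  assumes "C1_at f x D"
  shows "C1_at (\<lambda>y. c * f y) x (\<lambda>h. c * D h)"
  by (rule C1_at_compose[OF assms C1_at_bounded_linear[OF bounded_linear_mult_right]])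

lemma C1_at_diff:
  fixes f g :: "'a::real_normed_vector \<Rightarrow> real"
  assumes "C1_at f x D" "C1_at g x E"
  shows "C1_at (\<lambda>y. f y - g y) x (\<lambda>h. D h - E h)"
  using C1_at_add[OF assms(1) C1_at_cmult[OF assms(2), of "-1"]] by simp

lemma C1_at_cong_deriv: "C1_at f x D \<Longrightarrow> D = E \<Longrightarrow> C1_at f x E"
  by simp

lemma C1_at_coord:
  "C1_at (\<lambda>p. c + fst p $ i) (0 :: (real^'n) \<times> 'b::real_normed_vector) (\<lambda>h. fst h $ i)"
  "C1_at (\<lambda>p. c + snd p $ i) (0 :: 'b \<times> (real^'n)) (\<lambda>h. snd h $ i)"
proof -
  have "bounded_linear (\<lambda>p :: (real^'n) \<times> 'b. fst p $ i)" "bounded_linear (\<lambda>p :: 'b \<times> (real^'n). snd p $ i)"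
    by (auto intro!: bounded_linear_compose[OF bounded_linear_vec_nth] bounded_linear_fst bounded_linear_snd)
  from this[THEN C1_at_bounded_linear]
  show "C1_at (\<lambda>p. c + fst p $ i) (0 :: (real^'n) \<times> 'b) (\<lambda>h. fst h $ i)"
    "C1_at (\<lambda>p. c + snd p $ i) (0 :: 'b \<times> (real^'n)) (\<lambda>h. snd h $ i)"
    using C1_at_add[OF C1_at_const[of c]] by fastforce+
qed

section \<open>Linearizing the equilibrium conditions\<close>

lemma smooth_increasing_concave_DERIV:
  assumes "smooth_increasing_concave g" "0 < c"
  shows "(g has_real_derivative deriv g c) (at c)"
    and "(deriv g has_real_derivative deriv (deriv g) c) (at c)"
    and "0 < deriv g c" "deriv (deriv g) c < 0"
    and "C1_at g c (\<lambda>h. deriv g c * h)" "C1_at (deriv g) c (\<lambda>h. deriv (deriv g) c * h)"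
proof -
  have g: "g differentiable_on {0<..}" "deriv g differentiable_on {0<..}" "continuous_on {0<..} (deriv (deriv g))"
    and sgn: "\<And>c. 0 < c \<Longrightarrow> 0 < deriv g c" "\<And>c. 0 < c \<Longrightarrow> deriv (deriv g) c < 0"
    using assms(1) by (auto simp: smooth_increasing_concave_def C2_on_open_def)
  have D: "(g has_real_derivative deriv g y) (at y)" "(deriv g has_real_derivative deriv (deriv g) y) (at y)"
    if "0 < y" for y
    using g(1,2) that by (auto simp: differentiable_on_eq_differentiable_at DERIV_deriv_iff_real_differentiable)
  show "(g has_real_derivative deriv g c) (at c)"
    "(deriv g has_real_derivative deriv (deriv g) c) (at c)"
    "0 < deriv g c" "deriv (deriv g) c < 0" using D sgn assms(2) by auto
  show "C1_at g c (\<lambda>h. deriv g c * h)"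
    by (rule C1_at_DERIV[of "{0<..}"]) (use D assms(2) differentiable_imp_continuous_on[OF g(2)] in auto)
  show "C1_at (deriv g) c (\<lambda>h. deriv (deriv g) c * h)"
    by (rule C1_at_DERIV[of "{0<..}"]) (use D assms(2) g(3) in auto)
qed

lemma regular_value_function_C1:
  assumes "regular_value_function km v" "0 < k" "k < km"
  shows "(v has_real_derivative deriv v k) (at k)" and "C1_at v k (\<lambda>h. deriv v k * h)"
proof -
  have v: "v differentiable_on {0<..<km}" "deriv v differentiable_on {0<..<km}"
    using assms(1) by (auto simp: regular_value_function_def)
  have D: "(v has_real_derivative deriv v y) (at y)" if "y \<in> {0<..<km}" for y
    using v(1) that by (auto simp: differentiable_on_eq_differentiable_at DERIV_deriv_iff_real_differentiable)
  show "(v has_real_derivative deriv v k) (at k)" using D assms by auto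
  show "C1_at v k (\<lambda>h. deriv v k * h)"
    by (rule C1_at_DERIV[of "{0<..<km}"]) (use D assms differentiable_imp_continuous_on[OF v(2)] in auto)
qed

text \<open>The difference of the two sides of an agent's equilibrium condition, \<open>x\<close> being the current
  consumption and \<open>c\<close>, \<open>c'\<close>, \<open>k\<close> the next state. Along a step the value function on the left-hand side is
  evaluated at the next capital stock, so that the current state enters only through \<open>x\<close>.\<close>

definition euler_gap :: "(real \<Rightarrow> real) \<Rightarrow> agent \<Rightarrow> real \<Rightarrow> real \<Rightarrow> real \<Rightarrow> real \<Rightarrow> real" where
  "euler_gap f A x c c' k =
     disc A x * U f A c c' k * deriv f k - (deriv (util A) x + deriv (disc A) x * val A k)"

text \<open>At a stationary state, \<open>\<alpha> f' = 1\<close> and the envelope condition \<open>v' = U f'\<close> make \<open>U\<close> a common factor of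
  all partial derivatives, and what remains are the quantities \<open>\<omega>\<close>, \<open>\<delta>\<close> and \<open>\<eta>\<close>. The coordinates are
  arbitrary functions of a parameter \<open>q\<close>, so that the lemma serves both agents.\<close>

lemma euler_gap_C1:
  fixes X Y Z K :: "'p::real_normed_vector \<Rightarrow> real"
  assumes A: "discount_factor (disc A)" "utility_function (util A)" "regular_value_function km (val A)"
    and f: "smooth_increasing_concave f"
    and pos: "0 < c" "0 < k" "k < km" and res: "f k - c - c' = k"
    and stat: "disc A c * deriv f k = 1" and env: "deriv (val A) k = U f A c c' k * deriv f k"
    and U0: "U f A c c' k \<noteq> 0"
    and C1: "C1_at X p DX" "C1_at Y p DY" "C1_at Z p DZ" "C1_at K p DK"
    and at: "X p = c" "Y p = c" "Z p = c'" "K p = k"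
  shows "C1_at (\<lambda>q. euler_gap f A (X q) (Y q) (Z q) (K q)) p
    (\<lambda>h. U f A c c' k * (omega f A c c' k * (DX h - DY h) - delta A c * DZ h + eta f A c k * DK h))"
proof -
  have sd: "smooth_increasing_concave (disc A)" and su: "smooth_increasing_concave (util A)"
    using A by (auto simp: discount_factor_def utility_function_def)
  note d = smooth_increasing_concave_DERIV[OF sd pos(1)] and u = smooth_increasing_concave_DERIV[OF su pos(1)]
    and F = smooth_increasing_concave_DERIV[OF f pos(2)] and v = regular_value_function_C1[OF A(3) pos(2,3)]
  have S: "C1_at (\<lambda>q. f (K q) - Y q - Z q) p (\<lambda>h. deriv f k * DK h - DY h - DZ h)"
    by (intro C1_at_diff C1_at_compose[OF C1(4), unfolded at, OF F(5)] C1)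
  note S' = C1_at_compose[OF S, unfolded at res, OF v(2)]
  have a0: "disc A c \<noteq> 0" using stat by auto
  then have F0: "deriv f k = 1 / disc A c" using stat by (simp add: field_simps)
  have W: "W f A c c' k = U f A c c' k * (delta A c - omega f A c c' k)"
    using U0 by (simp add: omega_def delta_def)
  have Wv: "deriv (deriv (util A)) c = W f A c c' k - deriv (deriv (disc A)) c * val A k"
    by (simp add: W_def res)
  have u1: "deriv (util A) c = U f A c c' k - deriv (disc A) c * val A k" by (simp add: U_def res)
  show ?thesis
    unfolding euler_gap_def U_def[of f A "Y _"]
    \<comment> \<open>The closure rules compute the derivative; it is then rewritten in terms of \<open>U\<close>, \<open>\<omega>\<close>, \<open>\<delta>\<close>, \<open>\<eta>\<close>.\<close>
    apply (rule C1_at_cong_deriv)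
     apply (rule C1_at_diff C1_at_mult C1_at_add C1_at_compose[OF C1(1), unfolded at, OF d(5)]
        C1_at_compose[OF C1(1), unfolded at, OF d(6)] C1_at_compose[OF C1(1), unfolded at, OF u(6)]
        C1_at_compose[OF C1(2), unfolded at, OF u(6)] C1_at_compose[OF C1(2), unfolded at, OF d(6)]
        C1_at_compose[OF C1(4), unfolded at, OF F(6)] C1_at_compose[OF C1(4), unfolded at, OF v(2)] S')+
    apply (rule ext)
    unfolding at res Wv u1 W env delta_def eta_def F0
    using a0 by (simp add: field_simps)
qed

text \<open>The competitor \<open>z\<close> is not required to respect the upper bounds of the strategy spaces. The orbits
  constructed below may violate these bounds when the stationary state lies on the boundary; by this
  lemma, no equilibrium path then starts at their initial state. As both agents' marginal terms \<open>U\<close> decrease in own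
  and in total consumption, two different successors would contradict one of the two conditions.\<close>

lemma next_state_unique:
  assumes G: "precommitment_game f km Ai Aj" and step: "equilibrium_step f km Ai Aj x y"
    and z: "0 < z $ 1" "0 < z $ 2" "z $ 3 = f (x $ 3) - x $ 1 - x $ 2" "0 \<le> f (z $ 3) - z $ 1 - z $ 2"
    and zi: "U f Ai (x $ 1) (x $ 2) (x $ 3) = disc Ai (x $ 1) * U f Ai (z $ 1) (z $ 2) (z $ 3) * deriv f (z $ 3)"
    and zj: "U f Aj (x $ 2) (x $ 1) (x $ 3) = disc Aj (x $ 2) * U f Aj (z $ 2) (z $ 1) (z $ 3) * deriv f (z $ 3)"
  shows "y = z"
proof -
  have sf: "smooth_increasing_concave f" and km: "f km = km"
    using G by (auto simp: precommitment_game_def production_function_def)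
  have agents: "discount_factor (disc A)" "utility_function (util A)" "regular_value_function km (val A)"
    if "A \<in> {Ai, Aj}" for A
    using G that by (auto simp: precommitment_game_def)
  have x: "0 < x $ 1" "0 < x $ 2" and y: "0 < y $ 1" "0 < y $ 2" "0 < y $ 3" "y $ 3 \<le> km"
      "0 \<le> f (y $ 3) - y $ 1 - y $ 2"
    and yz: "y $ 3 = z $ 3"
    and yi: "U f Ai (x $ 1) (x $ 2) (x $ 3) = disc Ai (x $ 1) * U f Ai (y $ 1) (y $ 2) (y $ 3) * deriv f (y $ 3)"
    and yj: "U f Aj (x $ 2) (x $ 1) (x $ 3) = disc Aj (x $ 2) * U f Aj (y $ 2) (y $ 1) (y $ 3) * deriv f (y $ 3)"
    using step z(3) by (auto simp: equilibrium_step_def interior_state_def state_space_def)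
  have "strict_mono_on {0..} f" using sf by (simp add: smooth_increasing_concave_def)
  then have fk: "f (y $ 3) \<le> km"
    using y(3,4) km strict_mono_onD[of "{0..}" f "y $ 3" km] by (cases "y $ 3 = km") auto
  have f'pos: "0 < deriv f (y $ 3)" by (rule smooth_increasing_concave_DERIV(3)[OF sf y(3)])
  have dpos: "0 < disc A c" if "A \<in> {Ai, Aj}" "0 < c" for A c
  proof -
    have "0 < disc A 0" "strict_mono_on {0..} (disc A)"
      using agents(1)[OF that(1)] by (auto simp: discount_factor_def smooth_increasing_concave_def)
    then show ?thesis using that(2) strict_mono_onD[of "{0..}" "disc A" 0 c] by auto
  qed
  have Ui: "U f Ai (y $ 1) (y $ 2) (y $ 3) = U f Ai (z $ 1) (z $ 2) (y $ 3)"
    using yi zi yz f'pos dpos[of Ai "x $ 1"] x by auto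
  have Uj: "U f Aj (y $ 2) (y $ 1) (y $ 3) = U f Aj (z $ 2) (z $ 1) (y $ 3)"
    using yj zj yz f'pos dpos[of Aj "x $ 2"] x by auto
  have less: "U f A a' b' (y $ 3) < U f A a b (y $ 3)"
    if "A \<in> {Ai, Aj}" "0 \<le> f (y $ 3) - a' - b'" "0 < a" "0 < b" "a \<le> a'" "a + b \<le> a' + b'"
      "a < a' \<or> a + b < a' + b'" for A a b a' b'
    using U_strict_decreasing[where f = f and k = "y $ 3", OF agents(1)[OF that(1)] agents(2)[OF that(1)] agents(3)[OF that(1)] fk] that(2-) by auto
  have no: False
    if "A \<in> {Ai, Aj}" "U f A a b (y $ 3) = U f A a' b' (y $ 3)" "0 \<le> f (y $ 3) - a' - b'" "0 < a" "0 < b"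
      "a \<le> a'" "a + b \<le> a' + b'" "\<not> (a = a' \<and> b = b')" for A a b a' b'
  proof -
    have "a < a' \<or> a + b < a' + b'" using that by linarith
    from less[OF that(1,3-7) this] that(2) show False by simp
  qed
  have "y $ 1 = z $ 1 \<and> y $ 2 = z $ 2"
  proof (rule ccontr)
    assume ne: "\<not> (y $ 1 = z $ 1 \<and> y $ 2 = z $ 2)"
    consider "y $ 1 \<le> z $ 1" "y $ 1 + y $ 2 \<le> z $ 1 + z $ 2"
      | "z $ 1 \<le> y $ 1" "z $ 1 + z $ 2 \<le> y $ 1 + y $ 2"
      | "y $ 2 \<le> z $ 2" "y $ 2 + y $ 1 \<le> z $ 2 + z $ 1"
      | "z $ 2 \<le> y $ 2" "z $ 2 + z $ 1 \<le> y $ 2 + y $ 1"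
      by linarith
    then show False
    proof cases
      case 1 show False by (rule no[of Ai "y $ 1" "y $ 2" "z $ 1" "z $ 2"]) (use 1 ne y z yz Ui in auto)
    next
      case 2 show False by (rule no[of Ai "z $ 1" "z $ 2" "y $ 1" "y $ 2"]) (use 2 ne y z yz Ui in auto)
    next
      case 3 show False by (rule no[of Aj "y $ 2" "y $ 1" "z $ 2" "z $ 1"]) (use 3 ne y z yz Uj in auto)
    next
      case 4 show False by (rule no[of Aj "z $ 2" "z $ 1" "y $ 2" "y $ 1"]) (use 4 ne y z yz Uj in auto)
    qed
  qed
  then show ?thesis using yz by (simp add: vec_eq_iff forall_3)
qed

lemma equilibrium_path_step:
  assumes "precommitment_game f km Ai Aj" "equilibrium_path f km Ai Aj x"
  shows "equilibrium_step f km Ai Aj (x t) (x (Suc t))"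
  using assms Phi_eq_iff[OF assms(1), of "x t" "x (Suc t)"] by (auto simp: equilibrium_path_def)

text \<open>The stationary consumption is an interior maximiser, so the derivative of the maximand vanishes there.\<close>

lemma bellman_first_order_condition:
  assumes A: "discount_factor (disc A)" "utility_function (util A)" "regular_value_function km (val A)"
    and bel: "bellman f A c c' k"
    and pos: "0 < c" "0 < k" "k < km" and res: "f k - c - c' = k"
  shows "U f A c c' k = disc A c * deriv (val A) k"
proof -
  have sd: "smooth_increasing_concave (disc A)" and su: "smooth_increasing_concave (util A)"
    using A by (auto simp: discount_factor_def utility_function_def)
  define g where "g y = util A y + disc A y * val A (f k - y - c')" for y
  have v: "((\<lambda>y. val A (f k - y - c')) has_real_derivative deriv (val A) k * (- 1)) (at c)"
  proof (rule DERIV_chain2[of "val A"])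
    show "(val A has_real_derivative deriv (val A) k) (at (f k - c - c'))"
      unfolding res by (rule regular_value_function_C1(1)[OF A(3) pos(2,3)])
    show "((\<lambda>y. f k - y - c') has_real_derivative - 1) (at c)"
      by (auto intro!: derivative_eq_intros)
  qed
  have g': "(g has_real_derivative deriv (util A) c +
      (deriv (disc A) c * val A (f k - c - c') + deriv (val A) k * (- 1) * disc A c)) (at c)"
    unfolding g_def
    by (intro DERIV_add DERIV_mult v smooth_increasing_concave_DERIV(1)[OF sd pos(1)]
        smooth_increasing_concave_DERIV(1)[OF su pos(1)])
  have max: "g y \<le> g c" if "0 \<le> y" "y \<le> f k - c'" for y
    using bel that unfolding bellman_def is_arg_max_def g_def by (force simp: not_less)
  have "deriv (util A) c + (deriv (disc A) c * val A (f k - c - c') + deriv (val A) k * (- 1) * disc A c) = 0"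
  proof (rule DERIV_local_max[OF g'])
    show "0 < min c k" using pos by simp
    show "\<forall>y. \<bar>c - y\<bar> < min c k \<longrightarrow> g y \<le> g c"
      using res by (auto intro!: max)
  qed
  then show ?thesis by (simp add: U_def algebra_simps)
qed

text \<open>The envelope condition holds at a stationary state because the first order condition reads
  \<open>U = \<alpha> v'\<close> and stationarity gives \<open>\<alpha> f' = 1\<close>. The sign of \<open>\<omega>\<close> comes from \<open>W < 0 < U\<close>.\<close>

lemma stationary_agent:
  assumes A: "discount_factor (disc A)" "utility_function (util A)" "regular_value_function km (val A)"
    and bel: "bellman f A c c' k"
    and pos: "0 < c" "0 < k" "k < km" and res: "f k - c - c' = k"
    and euler: "U f A c c' k = disc A c * U f A c c' k * deriv f k"
  shows "0 < U f A c c' k" "disc A c * deriv f k = 1" "deriv (val A) k = U f A c c' k * deriv f k"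
    "0 < delta A c" "0 < omega f A c c' k"
proof -
  have sd: "smooth_increasing_concave (disc A)" and su: "smooth_increasing_concave (util A)"
    and d0: "0 < disc A 0"
    using A by (auto simp: discount_factor_def utility_function_def)
  note d = smooth_increasing_concave_DERIV[OF sd pos(1)] and u = smooth_increasing_concave_DERIV[OF su pos(1)]
  have v0: "0 \<le> val A k" using A(3) pos by (auto simp: regular_value_function_def)
  show U: "0 < U f A c c' k" using d(3) u(3) v0 by (auto simp: U_def res intro!: add_pos_nonneg)
  show stat: "disc A c * deriv f k = 1"
    using euler U by (simp add: mult.assoc mult.left_commute[of "disc A c"])
  have "U f A c c' k * deriv f k = (disc A c * deriv f k) * deriv (val A) k"
    using bellman_first_order_condition[OF A bel pos res] by simp
  then show "deriv (val A) k = U f A c c' k * deriv f k" by (simp add: stat)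
  have dpos: "0 < disc A c"
    using d0 pos(1) sd strict_mono_onD[of "{0..}" "disc A" 0 c]
    by (auto simp: smooth_increasing_concave_def)
  show delta: "0 < delta A c" using d(3) dpos by (simp add: delta_def)
  have "W f A c c' k < 0"
    using u(4) d(4) v0 by (auto simp: W_def res intro!: add_neg_nonpos mult_nonpos_nonneg)
  then show "0 < omega f A c c' k"
    using delta U by (auto simp: omega_def delta_def intro!: less_trans[OF divide_neg_pos])
qed


text \<open>Read backwards in time, the equilibrium conditions have a positive linear part: for displacements
  \<open>x\<close>, \<open>y\<close> of the current and the next state they become, to first order,
  \<open>x\<^sub>1 = y\<^sub>1 + (\<delta>\<^sub>i / \<omega>\<^sub>i) y\<^sub>2 - (\<eta>\<^sub>i / \<omega>\<^sub>i) y\<^sub>3\<close>,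
  \<open>x\<^sub>2 = (\<delta>\<^sub>j / \<omega>\<^sub>j) y\<^sub>1 + y\<^sub>2 - (\<eta>\<^sub>j / \<omega>\<^sub>j) y\<^sub>3\<close> and \<open>f' x\<^sub>3 = y\<^sub>3 + x\<^sub>1 + x\<^sub>2\<close>, where \<open>\<eta>\<^sub>i\<close> and \<open>\<eta>\<^sub>j\<close> are
  negative. Substituting the first two equations into the third yields the rows of \<open>C\<close>.\<close>

lemma backward_linearization:
  fixes f :: "real \<Rightarrow> real" and km ci cj k :: real and Ai Aj :: agent
  assumes agents: "\<And>A. A \<in> {Ai, Aj} \<Longrightarrow>
      discount_factor (disc A) \<and> utility_function (util A) \<and> regular_value_function km (val A)"
    and sf: "smooth_increasing_concave f"
    and pos: "0 < ci" "0 < cj" "0 < k" "k < km" and res: "f k - ci - cj = k"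
    and bel: "bellman f Ai ci cj k" "bellman f Aj cj ci k"
    and euler: "U f Ai ci cj k = disc Ai ci * U f Ai ci cj k * deriv f k"
      "U f Aj cj ci k = disc Aj cj * U f Aj cj ci k * deriv f k"
    and eta: "eta f Ai ci k < 0" "eta f Aj cj k < 0"
  obtains C :: "real^3^3" and R :: "(real^3) \<times> (real^3) \<Rightarrow> real^3" where
    "\<And>r s. 0 < C $ r $ s" "C $ 1 $ 1 = 1" "R 0 = 0" "C1_at R 0 (\<lambda>_. 0)"
    "\<And>x y. x = C *v y + R (x, y) \<Longrightarrow>
       euler_gap f Ai (ci + x $ 1) (ci + y $ 1) (cj + y $ 2) (k + y $ 3) = 0 \<and>
       euler_gap f Aj (cj + x $ 2) (cj + y $ 2) (ci + y $ 1) (k + y $ 3) = 0 \<and>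
       k + y $ 3 = f (k + x $ 3) - (ci + x $ 1) - (cj + x $ 2)"
proof -
  have res': "f k - cj - ci = k" using res by simp
  note Ai = agents[of Ai, simplified] and Aj = agents[of Aj, simplified]
  note si = stationary_agent[OF conjunct1[OF Ai] conjunct1[OF conjunct2[OF Ai]] conjunct2[OF conjunct2[OF Ai]]
      bel(1) pos(1,3,4) res euler(1)]
  note sj = stationary_agent[OF conjunct1[OF Aj] conjunct1[OF conjunct2[OF Aj]] conjunct2[OF conjunct2[OF Aj]]
      bel(2) pos(2,3,4) res' euler(2)]
  define ui uj F where "ui = U f Ai ci cj k" and "uj = U f Aj cj ci k" and "F = deriv f k"
  define wi wj where "wi = omega f Ai ci cj k" and "wj = omega f Aj cj ci k"
  define di dj where "di = delta Ai ci" and "dj = delta Aj cj"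
  define ei ej where "ei = eta f Ai ci k" and "ej = eta f Aj cj k"
  have sgn: "0 < ui" "0 < uj" "0 < F" "0 < wi" "0 < wj" "0 < di" "0 < dj" "ei < 0" "ej < 0"
    using si sj eta smooth_increasing_concave_DERIV(3)[OF sf pos(3)]
    by (auto simp: ui_def uj_def F_def wi_def wj_def di_def dj_def ei_def ej_def)
  define Gi where "Gi p = (1 / (ui * wi)) * euler_gap f Ai (ci + fst p $ 1) (ci + snd p $ 1) (cj + snd p $ 2) (k + snd p $ 3)"
    for p :: "(real^3) \<times> (real^3)"
  define Gj where "Gj p = (1 / (uj * wj)) * euler_gap f Aj (cj + fst p $ 2) (cj + snd p $ 2) (ci + snd p $ 1) (k + snd p $ 3)"
    for p :: "(real^3) \<times> (real^3)"
  define Gk where "Gk p = f (k + fst p $ 3) - (ci + fst p $ 1) - (cj + fst p $ 2) - (k + snd p $ 3)"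
    for p :: "(real^3) \<times> (real^3)"
  \<comment> \<open>The terms \<open>Gi p + Gj p\<close> eliminate the current consumption from the third linear part.\<close>
  define G where "G p = ((\<chi> r. if r = 1 then Gi p else if r = 2 then Gj p else (1 / F) * (Gk p + (Gi p + Gj p))) :: real^3)"
    for p :: "(real^3) \<times> (real^3)"
  have "C1_at Gi 0 (\<lambda>h. (1 / (ui * wi)) * (ui * (wi * (fst h $ 1 - snd h $ 1) - di * snd h $ 2 + ei * snd h $ 3)))"
    unfolding Gi_def ui_def wi_def di_def ei_def
    using Ai sf pos res si(2,3) sgn(1)[unfolded ui_def]
    by (intro C1_at_cmult euler_gap_C1[where km = km] C1_at_coord) auto
  then have Gi: "C1_at Gi 0 (\<lambda>h. fst h $ 1 - snd h $ 1 - di / wi * snd h $ 2 + ei / wi * snd h $ 3)"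
    using sgn by (elim C1_at_cong_deriv) (auto simp: field_simps)
  have "C1_at Gj 0 (\<lambda>h. (1 / (uj * wj)) * (uj * (wj * (fst h $ 2 - snd h $ 2) - dj * snd h $ 1 + ej * snd h $ 3)))"
    unfolding Gj_def uj_def wj_def dj_def ej_def
    using Aj sf pos res' sj(2,3) sgn(2)[unfolded uj_def]
    by (intro C1_at_cmult euler_gap_C1[where km = km] C1_at_coord) auto
  then have Gj: "C1_at Gj 0 (\<lambda>h. fst h $ 2 - snd h $ 2 - dj / wj * snd h $ 1 + ej / wj * snd h $ 3)"
    using sgn by (elim C1_at_cong_deriv) (auto simp: field_simps)
  have "C1_at f (k + fst (0 :: (real^3) \<times> (real^3)) $ 3) (\<lambda>h. F * h)"
    using smooth_increasing_concave_DERIV(5)[OF sf pos(3)] by (simp add: F_def)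
  note Cf = C1_at_compose[OF C1_at_coord(1) this]
  have Gk: "C1_at Gk 0 (\<lambda>h. F * fst h $ 3 - fst h $ 1 - fst h $ 2 - snd h $ 3)"
    unfolding Gk_def by (intro C1_at_diff Cf C1_at_coord)
  define DG where "DG h = ((\<chi> r. if r = 1 then fst h $ 1 - snd h $ 1 - di / wi * snd h $ 2 + ei / wi * snd h $ 3
      else if r = 2 then fst h $ 2 - snd h $ 2 - dj / wj * snd h $ 1 + ej / wj * snd h $ 3
      else (1 / F) * ((F * fst h $ 3 - fst h $ 1 - fst h $ 2 - snd h $ 3) +
        ((fst h $ 1 - snd h $ 1 - di / wi * snd h $ 2 + ei / wi * snd h $ 3) +
         (fst h $ 2 - snd h $ 2 - dj / wj * snd h $ 1 + ej / wj * snd h $ 3)))) :: real^3)"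
    for h :: "(real^3) \<times> (real^3)"
  have G: "C1_at G 0 DG"
  proof (rule C1_at_vec)
    fix r :: 3
    show "C1_at (\<lambda>p. G p $ r) 0 (\<lambda>h. DG h $ r)"
      using exhaust_3[of r] Gi Gj C1_at_cmult[OF C1_at_add[OF Gk C1_at_add[OF Gi Gj]], of "1 / F"]
      by (auto simp: G_def DG_def)
  qed
  define C :: "real^3^3" where "C = (\<chi> r s.
      if r = 1 then (if s = 1 then 1 else if s = 2 then di / wi else - (ei / wi))
      else if r = 2 then (if s = 1 then dj / wj else if s = 2 then 1 else - (ej / wj))
      else (if s = 1 then (1 + dj / wj) / F else if s = 2 then (di / wi + 1) / F else (1 - ei / wi - ej / wj) / F))"
  define R where "R p = (fst p - C *v snd p) + (- 1) *\<^sub>R G p" for p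
  have DG: "DG h = fst h - C *v snd h" for h
    using sgn by (simp add: vec_eq_iff forall_3 DG_def C_def matrix_vector_mult_def sum_3 field_simps)
  show thesis
  proof (rule that[of C R])
    have "ei / wi < 0" "ej / wj < 0" using sgn by (auto intro: divide_neg_pos)
    then have "0 < 1 - ei / wi - ej / wj" by linarith
    then show "0 < C $ r $ s" for r s
      using exhaust_3[of r] exhaust_3[of s] sgn
      by (auto simp: C_def divide_neg_pos add_pos_pos)
    show "C $ 1 $ 1 = 1" by (simp add: C_def)
    have "euler_gap f Ai ci ci cj k = 0"
      unfolding euler_gap_def euler(1)[symmetric] by (simp add: U_def res)
    moreover have "euler_gap f Aj cj cj ci k = 0"
      unfolding euler_gap_def euler(2)[symmetric] by (simp add: U_def res')
    ultimately have "G 0 = 0" using res by (simp add: G_def Gi_def Gj_def Gk_def vec_eq_iff)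
    then show "R 0 = 0" by (simp add: R_def)
    have "bounded_linear (\<lambda>p. fst p - C *v snd p)"
      by (intro bounded_linear_sub bounded_linear_fst
          bounded_linear_compose[OF matrix_vector_mul_bounded_linear] bounded_linear_snd)
    from C1_at_add[OF C1_at_bounded_linear[OF this] C1_at_compose[OF G C1_at_bounded_linear[OF bounded_linear_scaleR_right]]]
    show "C1_at R 0 (\<lambda>_. 0)"
      unfolding R_def by (rule C1_at_cong_deriv) (simp add: DG)
    fix x y :: "real^3" assume "x = C *v y + R (x, y)"
    then have "G (x, y) = 0" by (simp add: R_def)
    then have "G (x, y) $ 1 = 0" "G (x, y) $ 2 = 0" "G (x, y) $ 3 = 0" by auto
    then show "euler_gap f Ai (ci + x $ 1) (ci + y $ 1) (cj + y $ 2) (k + y $ 3) = 0 \<and>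
       euler_gap f Aj (cj + x $ 2) (cj + y $ 2) (ci + y $ 1) (k + y $ 3) = 0 \<and>
       k + y $ 3 = f (k + x $ 3) - (ci + x $ 1) - (cj + x $ 2)"
      using sgn by (simp add: G_def Gi_def Gj_def Gk_def)
  qed
qed

section \<open>Convergence along the stable curve\<close>

theorem theorem4p7:
  fixes f :: "real \<Rightarrow> real" and km ci cj k :: real and Ai Aj :: agent and xbar :: "real^3"
  assumes game: "precommitment_game f km Ai Aj"
    and stationary: "stationary_equilibrium f km Ai Aj xbar"
    and xbar: "ci = xbar $ 1" "cj = xbar $ 2" "k = xbar $ 3"
    and bellman_i: "bellman f Ai ci cj k"
    and bellman_j: "bellman f Aj cj ci k"
    and P1: "eta f Ai ci k < 0" "eta f Aj cj k < 0"
    and P2: "delta Ai ci \<le> delta Aj cj"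
    and P3: "deriv f k
      - (2 * omega f Ai ci cj k * omega f Aj cj ci k
         + (delta Ai ci - omega f Ai ci cj k) * eta f Aj cj k
         + eta f Ai ci k * (delta Aj cj - omega f Aj cj ci k)) \<ge> 0"
  shows "\<exists>(N :: (real^3) set) (\<phi> :: real^3 \<Rightarrow> real^2).
    open N \<and> xbar \<in> N \<and>
    \<phi> differentiable_on N \<and> continuous_on N (\<lambda>x. jacobian \<phi> (at x)) \<and>
    \<phi> xbar = 0 \<and> rank (jacobian \<phi> (at xbar)) = 2 \<and>
    (\<forall>x :: nat \<Rightarrow> real^3.
       equilibrium_path f km Ai Aj x \<longrightarrow> x 0 \<in> N \<longrightarrow> \<phi> (x 0) = 0 \<longrightarrow> x \<longlonglongrightarrow> xbar)"
proof -
  have step: "equilibrium_step f km Ai Aj xbar xbar"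
    using stationary Phi_eq_iff[OF game] by (auto simp: stationary_equilibrium_def)
  have agents: "discount_factor (disc A) \<and> utility_function (util A) \<and> regular_value_function km (val A)"
    if "A \<in> {Ai, Aj}" for A
    using game that by (auto simp: precommitment_game_def)
  have sf: "smooth_increasing_concave f" and km: "f km = km"
    using game by (auto simp: precommitment_game_def production_function_def)
  have pos: "0 < ci" "0 < cj" "0 < k" "k \<le> km" and res: "f k - ci - cj = k"
    and euler: "U f Ai ci cj k = disc Ai ci * U f Ai ci cj k * deriv f k"
      "U f Aj cj ci k = disc Aj cj * U f Aj cj ci k * deriv f k"
    using step by (auto simp: equilibrium_step_def interior_state_def state_space_def xbar)
  have kkm: "k < km" using pos res km by (cases "k = km") auto

  obtain C :: "real^3^3" and R :: "(real^3) \<times> (real^3) \<Rightarrow> real^3" where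
    C: "\<And>r s. 0 < C $ r $ s" "C $ 1 $ 1 = 1" and R: "C1_at R 0 (\<lambda>_. 0)" "R 0 = 0"
    and gap: "\<And>x y. x = C *v y + R (x, y) \<Longrightarrow>
       euler_gap f Ai (ci + x $ 1) (ci + y $ 1) (cj + y $ 2) (k + y $ 3) = 0 \<and>
       euler_gap f Aj (cj + x $ 2) (cj + y $ 2) (ci + y $ 1) (k + y $ 3) = 0 \<and>
       k + y $ 3 = f (k + x $ 3) - (ci + x $ 1) - (cj + x $ 2)"
    by (rule backward_linearization[OF agents sf pos(1-3) kkm res bellman_i bellman_j euler P1]) (assumption, rule that)
  obtain S R' where S: "open S" "0 \<in> S"
    and R': "\<And>p. p \<in> S \<Longrightarrow> (R has_derivative blinfun_apply (R' p)) (at p)" "continuous_on S R'"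
      "blinfun_apply (R' 0) = (\<lambda>_. 0)"
    by (rule C1_atE[OF R(1)]) (rule that)
  have R'0: "R' 0 = 0" by (rule blinfun_eqI) (simp add: R'(3))

  \<comment> \<open>States within distance \<open>\<eta>\<close> satisfy the inequalities under which the next state is unique.\<close>
  obtain \<eta> where \<eta>: "0 < \<eta>" "\<And>h :: real^3. norm h \<le> \<eta> \<Longrightarrow>
      0 < ci + h $ 1 \<and> 0 < cj + h $ 2 \<and> 0 < k + h $ 3 \<and> 0 < f (k + h $ 3) - (ci + h $ 1) - (cj + h $ 2)"
  proof -
    have coord: "((\<lambda>h :: real^3. c + h $ i) \<longlongrightarrow> c) (nhds 0)" for c i
    proof -
      have "((\<lambda>h :: real^3. c + h $ i) \<longlongrightarrow> c + (0 :: real^3) $ i) (nhds 0)"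
        by (intro tendsto_intros filterlim_ident)
      then show ?thesis by simp
    qed
    have "isCont f k" using smooth_increasing_concave_DERIV(1)[OF sf pos(3)] by (rule DERIV_isCont)
    then have "((\<lambda>h :: real^3. f (k + h $ 3)) \<longlongrightarrow> f k) (nhds 0)"
      using coord by (rule isCont_tendsto_compose)
    from tendsto_diff[OF tendsto_diff[OF this coord[of ci 1]] coord[of cj 2]]
    have lim: "((\<lambda>h :: real^3. f (k + h $ 3) - (ci + h $ 1) - (cj + h $ 2)) \<longlongrightarrow> k) (nhds 0)"
      unfolding res .
    have "\<forall>\<^sub>F h in nhds (0 :: real^3). 0 < ci + h $ 1 \<and> 0 < cj + h $ 2 \<and> 0 < k + h $ 3 \<and>
        0 < f (k + h $ 3) - (ci + h $ 1) - (cj + h $ 2)"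
      by (intro eventually_conj order_tendstoD(1)[OF coord] order_tendstoD(1)[OF lim] pos)
    then obtain d where d: "0 < d" "\<forall>h :: real^3. dist h 0 < d \<longrightarrow> 0 < ci + h $ 1 \<and> 0 < cj + h $ 2 \<and>
        0 < k + h $ 3 \<and> 0 < f (k + h $ 3) - (ci + h $ 1) - (cj + h $ 2)"
      unfolding eventually_nhds_metric by (elim exE conjE) (rule that)
    show thesis
    proof (rule that[of "d / 2"])
      show "0 < d / 2" using d(1) by simp
      fix h :: "real^3" assume "norm h \<le> d / 2"
      then have "dist h 0 < d" using d(1) by simp
      then show "0 < ci + h $ 1 \<and> 0 < cj + h $ 2 \<and> 0 < k + h $ 3 \<and>
          0 < f (k + h $ 3) - (ci + h $ 1) - (cj + h $ 2)"
        using d(2) by blast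
    qed
  qed

  have C11: "1 \<le> C $ 1 $ 1" and ne: "(1 :: 3) \<noteq> 2" by (simp_all add: C(2))
  obtain l \<delta> \<sigma> \<sigma>' where \<sigma>': "\<And>s. \<bar>s\<bar> < \<delta> \<Longrightarrow> (\<sigma> has_vector_derivative \<sigma>' s) (at s)"
    and l: "\<And>i. 0 < l $ i" and \<delta>: "0 < \<delta>" and \<sigma>0: "\<sigma> 0 = 0"
    and \<sigma>'c: "continuous_on {-\<delta><..<\<delta>} \<sigma>'"
    and l\<sigma>: "\<And>s. \<bar>s\<bar> < \<delta> \<Longrightarrow> l \<bullet> \<sigma> s = s"
    and orbit: "\<And>s. \<bar>s\<bar> < \<delta> \<Longrightarrow> \<exists>x :: nat \<Rightarrow> real^3. x 0 = \<sigma> s \<and> (\<forall>t. norm (x t) \<le> \<eta>) \<and>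
        (\<forall>t. x t = C *v x (Suc t) + R (x t, x (Suc t))) \<and> x \<longlonglongrightarrow> 0"
    by (rule stable_curve_positive_matrix[OF C(1) C11 ne S R'(1,2) R(2) R'0 \<eta>(1)]) (assumption, rule that)

  \<comment> \<open>Two coordinates determine a vector in the kernel of \<open>l\<close>, as the third entry of \<open>l\<close> is positive.\<close>
  define Q :: "real^3 \<Rightarrow> real^2" where "Q v = (\<chi> i. if i = 1 then v $ 1 else v $ 2)" for v
  have bQ: "bounded_linear Q"
    unfolding linear_conv_bounded_linear[symmetric] by (simp add: Q_def linear_iff vec_eq_iff)
  have Qinj: "v = 0" if "Q v = 0" "l \<bullet> v = 0" for v
  proof -
    have "v $ 1 = 0" "v $ 2 = 0"
      using arg_cong[OF that(1), of "\<lambda>w. w $ 1"] arg_cong[OF that(1), of "\<lambda>w. w $ 2"] by (auto simp: Q_def)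
    moreover from this have "v $ 3 = 0" using that(2) l[of 3] by (simp add: inner_vec_def sum_3)
    ultimately show ?thesis by (simp add: vec_eq_iff forall_3)
  qed
  define s where "s x = l \<bullet> (x - xbar)" for x
  define N where "N = {x. \<bar>s x\<bar> < \<delta>}"
  define \<phi> where "\<phi> x = Q (x - xbar - \<sigma> (s x))" for x
  define D\<phi> where "D\<phi> x h = Q (h - (l \<bullet> h) *\<^sub>R \<sigma>' (s x))" for x h
  have s_cont: "continuous_on UNIV s" unfolding s_def by (intro continuous_intros)
  have N: "open N" unfolding N_def by (intro open_Collect_less continuous_intros s_cont)
  have xN: "xbar \<in> N" using \<delta> by (simp add: N_def s_def)
  have der: "(\<phi> has_derivative D\<phi> x) (at x)" if "x \<in> N" for x
  proof -
    have "(s has_derivative (\<lambda>h. l \<bullet> h)) (at x)"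
      unfolding s_def by (auto intro!: derivative_eq_intros)
    then have "((\<lambda>x. \<sigma> (s x)) has_derivative (\<lambda>h. (l \<bullet> h) *\<^sub>R \<sigma>' (s x))) (at x)"
      using that has_derivative_compose[of s _ x UNIV \<sigma> "\<lambda>r. r *\<^sub>R \<sigma>' (s x)"] \<sigma>'[of "s x"]
      by (simp add: has_vector_derivative_def N_def)
    then have "((\<lambda>x. x - xbar - \<sigma> (s x)) has_derivative (\<lambda>h. h - (l \<bullet> h) *\<^sub>R \<sigma>' (s x))) (at x)"
      by (auto intro!: derivative_eq_intros)
    then show ?thesis unfolding \<phi>_def D\<phi>_def by (rule bounded_linear.has_derivative[OF bQ])
  qed
  have jac: "jacobian \<phi> (at x) = matrix (D\<phi> x)" if "x \<in> N" for x
    using frechet_derivative_at[OF der[OF that]] by (simp add: jacobian_def)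
  have "continuous_on N (\<lambda>x. \<sigma>' (s x))"
    by (rule continuous_on_compose2[OF \<sigma>'c continuous_on_subset[OF s_cont]]) (auto simp: N_def)
  then have "continuous_on N (\<lambda>x. matrix (D\<phi> x))"
    unfolding matrix_def D\<phi>_def
    by (intro continuous_on_vec_lambda continuous_on_component bounded_linear.continuous_on[OF bQ] continuous_intros)
  then have jac_cont: "continuous_on N (\<lambda>x. jacobian \<phi> (at x))"
    by (subst continuous_on_cong[OF refl jac]) auto
  have surj: "surj (D\<phi> xbar)"
  proof (rule surjI)
    fix w :: "real^2"
    \<comment> \<open>The preimage is taken in the kernel of \<open>l\<close>, where the curve does not contribute to the derivative.\<close>
    define h :: "real^3" where "h = (\<chi> i. if i = 1 then w $ 1 else if i = 2 then w $ 2 else - ((l $ 1 * w $ 1 + l $ 2 * w $ 2) / l $ 3))"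
    have "l \<bullet> h = 0" using l[of 3] by (simp add: inner_vec_def sum_3 h_def)
    then show "D\<phi> xbar h = w" by (simp add: D\<phi>_def Q_def h_def vec_eq_iff forall_2)
  qed
  have rank: "rank (jacobian \<phi> (at xbar)) = 2"
  proof -
    have "(\<phi> has_derivative (*v) (jacobian \<phi> (at xbar))) (at xbar)"
      using jacobian_works[of \<phi> "at xbar"] der[OF xN] by (auto simp: differentiable_def)
    then have "(*v) (jacobian \<phi> (at xbar)) = D\<phi> xbar"
      using der[OF xN] by (rule has_derivative_unique)
    then show ?thesis using surj full_rank_surjective[of "jacobian \<phi> (at xbar)"] by simp
  qed
  have conv: "x \<longlonglongrightarrow> xbar" if path: "equilibrium_path f km Ai Aj x" and x0: "x 0 \<in> N" "\<phi> (x 0) = 0" for x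
  proof -
    have s0: "\<bar>s (x 0)\<bar> < \<delta>" using x0(1) by (simp add: N_def)
    \<comment> \<open>This vector lies in the kernel of \<open>l\<close> because \<open>l \<bullet> \<sigma> s = s\<close>, so it vanishes together with \<open>\<phi>\<close>.\<close>
    have "x 0 - xbar - \<sigma> (s (x 0)) = 0"
      by (rule Qinj) (use x0(2) l\<sigma>[OF s0] in \<open>auto simp: \<phi>_def inner_diff_right s_def\<close>)
    from orbit[OF s0] obtain w where w: "w \<longlonglongrightarrow> 0" "w 0 = \<sigma> (s (x 0))" "\<forall>t. norm (w t) \<le> \<eta>"
      "\<forall>t. w t = C *v w (Suc t) + R (w t, w (Suc t))"
      by (elim exE conjE) (rule that)
    have "x t = xbar + w t" for t
    proof (induction t)
      case 0
      show ?case using \<open>x 0 - xbar - \<sigma> (s (x 0)) = 0\<close> w(2) by (simp add: algebra_simps)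
    next
      case (Suc t)
      note g = gap[OF w(4)[THEN spec, of t]] and p = \<eta>(2)[OF w(3)[THEN spec, of "Suc t"]]
      have K: "f (k + w t $ 3) - (ci + w t $ 1) - (cj + w t $ 2) = k + w (Suc t) $ 3"
        "f (k + w t $ 3) - (cj + w t $ 2) - (ci + w t $ 1) = k + w (Suc t) $ 3" using g by auto
      show ?case
      proof (rule next_state_unique[OF game equilibrium_path_step[OF game path, of t]])
        show "U f Ai (x t $ 1) (x t $ 2) (x t $ 3) = disc Ai (x t $ 1) *
            U f Ai ((xbar + w (Suc t)) $ 1) ((xbar + w (Suc t)) $ 2) ((xbar + w (Suc t)) $ 3) * deriv f ((xbar + w (Suc t)) $ 3)"
          using conjunct1[OF g] by (simp add: Suc.IH xbar[symmetric] euler_gap_def U_def[of f Ai "ci + w t $ 1"] K)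
        show "U f Aj (x t $ 2) (x t $ 1) (x t $ 3) = disc Aj (x t $ 2) *
            U f Aj ((xbar + w (Suc t)) $ 2) ((xbar + w (Suc t)) $ 1) ((xbar + w (Suc t)) $ 3) * deriv f ((xbar + w (Suc t)) $ 3)"
          using conjunct1[OF conjunct2[OF g]] by (simp add: Suc.IH xbar[symmetric] euler_gap_def U_def[of f Aj "cj + w t $ 2"] K)
      qed (use g p in \<open>auto simp: Suc.IH xbar[symmetric]\<close>)
    qed
    then have "x = (\<lambda>t. xbar + w t)" by auto
    then show ?thesis using tendsto_add[OF tendsto_const w(1), of xbar] by simp
  qed
  show ?thesis
  proof (intro exI[of _ N] exI[of _ \<phi>] conjI allI impI)
    show "\<phi> differentiable_on N"
      using der by (auto simp: differentiable_on_def differentiable_def intro: has_derivative_at_withinI)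
    show "\<phi> xbar = 0" using linear_0[OF bounded_linear.linear[OF bQ]] by (simp add: \<phi>_def s_def \<sigma>0)
  qed (use N xN jac_cont rank conv in auto)
qed

end
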